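(* Let $n\in\mathbb{N}^{\ast}$ and $X=K^{n}$. Let $(\omega_i)_{i\geq1}\subset Lip(T)$ have Lipschitz constants $r_i=\|\omega_i\|_L$ forming a bounded sequence, and let $(R_i)_{i\geq1}\subset\mathcal{L}(K^n)$ be such that $\sum_{i=1}^{\infty}\|R_i\|_o<\infty$. Let $H:cabv(K^n)\to cabv(K^n)$ be given by $H(\mu)=\sum_{i=1}^{\infty}R_i\circ\omega_i(\mu)$. Assume: (a) $d=\sum_{i=1}^{\infty}\|R_i\|_o(1+r_i)<1$ (this is true, in particular, if all $\omega_i$ are contractions and $\sum_{i=1}^{\infty}\|R_i\|_o\leq\frac12$); (b) $0<a<\infty$, $\mu^0\in cabv(K^n)$, $\emptyset\neq A\subseteq B_a(K^n)$ is weak$^{\ast}$ closed and $H(\mu)+\mu^0\in A$ for any $\mu\in A$. (In particular, if $\|\mu^0\|+a\sum_{i=1}^{\infty}\|R_i\|_o\leq a$, one can take $A=B_a(K^n)$.) Under these hypotheses, define $H_2:A\to A$ via $H_2(\mu)=H(\mu)+\mu^0$ for any $\mu\in A$. Then $H_2$ is a contraction with contraction factor $\leq d$ if $A$ is equipped with the metric $d_{MK}(\mu,\nu)=\|\mu-\nu\|_{MK}$. Moreover: (i) if $\mu^0=0$, then $0\in A$; (ii) there exists a unique $\mu^{\ast}\in A$ such that $H_2(\mu^{\ast})=\mu^{\ast}$; in case $\mu^0=0$, we have $\mu^{\ast}=0$.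
   Context: $K$ is $\mathbb{R}$ or $\mathbb{C}$; $K^n$ carries the standard scalar product $\langle x,y\rangle=\sum_i x_i\overline{y_i}$ and the Euclidean norm. $(T,\rho)$ is a compact metric space (metric denoted $\rho$ here) with at least two elements, $\mathcal{B}$ its Borel $\sigma$-algebra. $\mathbb{N}^{\ast}=\{1,2,\dots\}$. For a map $f$ from $T$ to a metric space $(Y,\sigma)$, $\|f\|_L=\sup\{\sigma(f(x),f(y))/\rho(x,y): x\neq y\}$; $Lip(T,Y)$ is the set of $f$ with $\|f\|_L<\infty$, $Lip(T)=Lip(T,T)$; a contraction is a Lipschitz self-map with $\|f\|_L<1$, and $\|f\|_L$ is its contraction factor. $\mathcal{L}(X)$ is the space of continuous linear operators on $X$, with operator norm $\|\cdot\|_o$. $cabv(X)$ is the space of $\sigma$-additive $\mu:\mathcal{B}\to X$ with finite total variation $\|\mu\|=|\mu|(T)=\sup\sum_i\|\mu(A_i)\|$ (supremum over finite Borel partitions $(A_i)$ of $T$); this is the variational norm. For continuous $h:T\to T$, $h(\mu)(B)=\mu(h^{-1}(B))$ for $B\in\mathcal{B}$; for $R\in\mathcal{L}(X)$, $(R\circ h(\mu))(B)=R(\mu(h^{-1}(B)))$. The series defining $H(\mu)$ converges absolutely in $cabv(X)$ for the variational norm. $B_a(X)=\{\mu\in cabv(X):\|\mu\|\leq a\}$. Integral: for a simple function $f=\sum_i\varphi_{A_i}x_i$ ($(A_i)$ a finite Borel partition of $T$, $x_i\in X$, $\varphi_A$ the indicator function of $A$), $\int f\,d\mu=\sum_i\langle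 x_i,\mu(A_i)\rangle$; for $f$ a uniform limit of simple functions $f_m$ (in particular for $f\in C(T,X)$, the continuous functions), $\int f\,d\mu=\lim_m\int f_m\,d\mu$. With $\|f\|_\infty$ the sup norm and $\|f\|_{BL}=\|f\|_\infty+\|f\|_L$ on $Lip(T,X)$, the Monge-Kantorovich norm on $cabv(X)$ is $\|\mu\|_{MK}=\sup\{|\int f\,d\mu|: f\in Lip(T,X),\ \|f\|_{BL}\leq 1\}$. The weak$^{\ast}$ topology on $cabv(K^n)$ is the one obtained from the identification $cabv(X)\equiv C(T,X)'$, $\mu\mapsto(f\mapsto\int f\,d\mu)$, i.e. the coarsest topology making all maps $\mu\mapsto\int f\,d\mu$, $f\in C(T,X)$, continuous. *)

theory Defs
  imports "HOL-Analysis.Analysis"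
begin

text \<open>
  The scalars are a type of class \<open>real_or_complex\<close>. The instances are the reals and the
  complex numbers, and by lemma \<open>real_or_complex_cases\<close> below every other instance
  is an isometric copy of one of these two, conjugation included.
\<close>

class real_or_complex = real_normed_field +
  fixes conjg :: "'a \<Rightarrow> 'a"
  assumes conjg_add: "conjg (x + y) = conjg x + conjg y"
    and mult_conjg_scaleR: "x * conjg x = (norm x)\<^sup>2 *\<^sub>R 1"

instantiation real :: real_or_complex
begin
definition conjg_real :: "real \<Rightarrow> real" where "conjg_real x = x"
instance by standard (auto simp: conjg_real_def power2_eq_square)
end

instantiation complex :: real_or_complex
begin
definition conjg_complex :: "complex \<Rightarrow> complex" where "conjg_complex = cnj"
instance by standard (auto simp: conjg_complex_def complex_norm_square scaleR_conv_of_real simp del: of_real_power)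
end

lemma mult_conjg: "x * conjg x = of_real ((norm x)\<^sup>2)" for x :: "'a::real_or_complex"
  by (simp only: mult_conjg_scaleR of_real_def)

lemma conjg_of_real: "conjg (of_real r :: 'a::real_or_complex) = of_real r"
proof (cases "r = 0")
  case True
  have "conjg (0 + 0 :: 'a) = conjg 0 + conjg 0" by (rule conjg_add)
  with True show ?thesis by simp
next
  case False
  have "of_real r * conjg (of_real r :: 'a) = of_real r * of_real r"
    using mult_conjg[of "of_real r :: 'a"] by (simp add: power2_eq_square flip: of_real_mult)
  with False show ?thesis by simp
qed

lemma add_conjg_real: "\<exists>s. x + conjg x = (of_real s :: 'a::real_or_complex)"
proof -
  have c1: "conjg (1::'a) = 1" using conjg_of_real[of 1] by simp
  have "(1 + x) * conjg (1 + x) = of_real ((norm (1 + x))\<^sup>2)" by (rule mult_conjg)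
  moreover have "(1 + x) * conjg (1 + x) = 1 + (x + conjg x) + x * conjg x"
    by (simp add: conjg_add c1 algebra_simps)
  ultimately have "x + conjg x = of_real ((norm (1 + x))\<^sup>2 - 1 - (norm x)\<^sup>2)"
    by (simp add: mult_conjg algebra_simps)
  then show ?thesis by blast
qed

lemma conjg_imag_part:
  fixes x :: "'a::real_or_complex"
  obtains r u where "x = of_real r + u" "conjg u = - u" "u * u = - of_real ((norm u)\<^sup>2)"
proof -
  obtain s where s: "x + conjg x = of_real s" using add_conjg_real by blast
  define h where "h = s / 2"
  define u where "u = x - of_real h"
  have "conjg (u + of_real h) = conjg u + of_real h" by (simp only: conjg_add conjg_of_real)
  then have cx: "conjg x = conjg u + of_real h" by (simp add: u_def)
  have "s = h + h" by (simp add: h_def)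
  then have "x + conjg x = of_real h + of_real h" using s by (simp only: of_real_add)
  then have cu: "conjg u = - u" unfolding cx by (simp add: u_def algebra_simps)
  have "u * u = - of_real ((norm u)\<^sup>2)" using mult_conjg[of u] unfolding cu
    by (metis minus_minus mult_minus_right)
  with cu show ?thesis by (intro that[of h u]) (simp_all add: u_def)
qed

lemma real_or_complex_cases:
  "(\<exists>\<phi> :: real \<Rightarrow> 'a::real_or_complex. bij \<phi> \<and>
      (\<forall>x y. \<phi> (x + y) = \<phi> x + \<phi> y \<and> \<phi> (x * y) = \<phi> x * \<phi> y) \<and>
      (\<forall>x. norm (\<phi> x) = norm x \<and> conjg (\<phi> x) = \<phi> x)) \<or>
   (\<exists>\<phi> :: complex \<Rightarrow> 'a. bij \<phi> \<and>
      (\<forall>x y. \<phi> (x + y) = \<phi> x + \<phi> y \<and> \<phi> (x * y) = \<phi> x * \<phi> y) \<and>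
      (\<forall>x. norm (\<phi> x) = norm x \<and> conjg (\<phi> x) = \<phi> (cnj x)))"
proof (cases "range (of_real :: real \<Rightarrow> 'a) = UNIV")
  case True
  have "bij (of_real :: real \<Rightarrow> 'a)" using True by (auto simp: bij_def inj_on_def)
  then show ?thesis by (intro disjI1 exI[of _ of_real]) (simp add: conjg_of_real)
next
  case False
  then obtain z :: 'a where z: "z \<notin> range of_real" by blast
  obtain r t where t: "z = of_real r + t" "conjg t = - t" "t * t = - of_real ((norm t)\<^sup>2)"
    by (rule conjg_imag_part)
  have t0: "t \<noteq> 0" using z t(1) by auto
  define j where "j = t / of_real (norm t)"
  have jj: "j * j = -1"
    using t(3) t0 by (simp add: j_def power2_eq_square)
  have nj: "norm j = 1" using t0 by (simp add: j_def norm_divide)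
  have cbj: "conjg (of_real b * j) = - (of_real b * j)" for b
  proof (cases "b = 0")
    case True
    then show ?thesis using conjg_of_real[of 0, where 'a='a] by simp
  next
    case False
    have "(of_real b * j) * conjg (of_real b * j) = of_real (b\<^sup>2)"
      by (simp only: mult_conjg norm_mult nj) simp
    also have "\<dots> = - (of_real b * of_real b * (j * j))"
      unfolding jj by (simp add: power2_eq_square)
    also have "\<dots> = (of_real b * j) * (- (of_real b * j))"
      by (simp add: algebra_simps)
    finally show ?thesis using False nj by (subst (asm) mult_cancel_left) auto
  qed
  define \<phi> where "\<phi> w = of_real (Re w) + of_real (Im w) * j" for w
  have add: "\<phi> (x + y) = \<phi> x + \<phi> y" for x y by (simp add: \<phi>_def algebra_simps)
  have mult: "\<phi> (x * y) = \<phi> x * \<phi> y" for x y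
  proof -
    have "\<phi> x * \<phi> y = of_real (Re x) * of_real (Re y) + of_real (Im x) * of_real (Im y) * (j * j)
        + (of_real (Re x) * of_real (Im y) + of_real (Im x) * of_real (Re y)) * j"
      by (simp add: \<phi>_def algebra_simps)
    then show ?thesis unfolding jj by (simp add: \<phi>_def)
  qed
  have cnj: "conjg (\<phi> x) = \<phi> (cnj x)" for x
    by (simp add: \<phi>_def conjg_add conjg_of_real cbj)
  have norm: "norm (\<phi> x) = norm x" for x
  proof -
    have "of_real ((norm (\<phi> x))\<^sup>2) = \<phi> (x * cnj x)" by (simp only: mult mult_conjg flip: cnj)
    also have "\<dots> = of_real ((norm x)\<^sup>2)"
      by (simp add: \<phi>_def cmod_power2 flip: power2_eq_square del: of_real_power)
    finally have "(norm (\<phi> x))\<^sup>2 = (norm x)\<^sup>2" by (simp only: of_real_eq_iff)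
    then show ?thesis by (simp add: power2_eq_iff_nonneg)
  qed
  have "inj \<phi>"
  proof (rule injI)
    fix x y assume "\<phi> x = \<phi> y"
    then have "\<phi> (x - y) = 0" using add[of "x - y" y] by simp
    then show "x = y" using norm[of "x - y"] by simp
  qed
  moreover have "surj \<phi>"
  proof (rule surjI)
    fix x :: 'a
    obtain a u where u: "x = of_real a + u" "conjg u = - u" "u * u = - of_real ((norm u)\<^sup>2)"
      by (rule conjg_imag_part)
    have "(u - of_real (norm u) * j) * (u + of_real (norm u) * j) =
        u * u - of_real (norm u) * of_real (norm u) * (j * j)"
      by (simp add: algebra_simps)
    also have "\<dots> = 0" unfolding jj u(3) by (simp add: power2_eq_square)
    finally have "u - of_real (norm u) * j = 0 \<or> u + of_real (norm u) * j = 0"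
      by (rule mult_eq_0_iff[THEN iffD1])
    then have "u = of_real (norm u) * j \<or> u = of_real (- norm u) * j"
      by (simp only: right_minus_eq eq_neg_iff_add_eq_0 of_real_minus mult_minus_left)
    then obtain b where "u = of_real b * j" by blast
    then have "\<phi> (Complex a b) = x" using u(1) by (simp add: \<phi>_def)
    then have "\<exists>w. \<phi> w = x" by blast
    then show "\<phi> (SOME w. \<phi> w = x) = x" by (rule someI_ex)
  qed
  ultimately have "bij \<phi>" by (rule bijI)
  then show ?thesis
    using add mult cnj norm by (intro disjI2 exI[of _ \<phi>] conjI allI) assumption+
qed

definition scalar_prod :: "'k::real_or_complex ^ 'n \<Rightarrow> 'k ^ 'n \<Rightarrow> 'k" where
  "scalar_prod x y = (\<Sum>i\<in>UNIV. x $ i * conjg (y $ i))"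

text \<open>
  The Lipschitz constant on \<open>S\<close>, with distance functions as arguments because the distances
  on measures used later are not those of a type class. With values in \<^typ>\<open>ennreal\<close> it is
  \<open>\<infinity>\<close> for non-Lipschitz maps and \<open>0\<close> if \<open>S\<close> is a singleton; moreover \<open>c / 0 = \<infinity>\<close> for \<open>c > 0\<close>,
  so a bound \<open>lip_const_on S \<rho> \<sigma> f \<le> d\<close> always gives \<open>\<sigma> (f x) (f y) \<le> d * \<rho> x y\<close>.
\<close>

definition lip_const_on ::
    "'a set \<Rightarrow> ('a \<Rightarrow> 'a \<Rightarrow> real) \<Rightarrow> ('b \<Rightarrow> 'b \<Rightarrow> real) \<Rightarrow> ('a \<Rightarrow> 'b) \<Rightarrow> ennreal" where
  "lip_const_on S \<rho> \<sigma> f =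
     Sup {ennreal (\<sigma> (f x) (f y)) / ennreal (\<rho> x y) | x y. x \<in> S \<and> y \<in> S \<and> x \<noteq> y}"

definition contraction_on :: "'a set \<Rightarrow> ('a \<Rightarrow> 'a \<Rightarrow> real) \<Rightarrow> ('a \<Rightarrow> 'a) \<Rightarrow> bool" where
  "contraction_on S \<rho> f \<longleftrightarrow> f \<in> S \<rightarrow> S \<and> lip_const_on S \<rho> \<rho> f < 1"

definition lip_const :: "('t::metric_space \<Rightarrow> 'y::metric_space) \<Rightarrow> ennreal" where
  "lip_const f = lip_const_on UNIV dist dist f"

definition Lip :: "('t::metric_space \<Rightarrow> 'y::metric_space) set" where
  "Lip = {f. lip_const f < \<infinity>}"

definition variation_sums :: "('t::topological_space set \<Rightarrow> 'x::real_normed_vector) \<Rightarrow> real set" where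
  "variation_sums \<mu> =
     {\<Sum>B\<in>P. norm (\<mu> B) | P. finite P \<and> P \<subseteq> sets borel \<and> partition_on UNIV P}"

text \<open>
  A measure is represented by a function on all sets that vanishes outside the Borel sets,
  so that equality of measures is equality on the Borel sets.
\<close>

typedef (overloaded) ('t::topological_space, 'x::real_normed_vector) cabv =
  "{\<mu> :: 't set \<Rightarrow> 'x.
      (\<forall>B. B \<notin> sets borel \<longrightarrow> \<mu> B = 0) \<and>
      (\<forall>B :: nat \<Rightarrow> 't set. range B \<subseteq> sets borel \<longrightarrow> disjoint_family B \<longrightarrow>
         (\<lambda>i. \<mu> (B i)) sums \<mu> (\<Union>i. B i)) \<and>
      bdd_above (variation_sums \<mu>)}"
  morphisms cabv_apply Abs_cabv
  by (rule exI[of _ "\<lambda>_. 0"]) (auto simp: variation_sums_def)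

setup_lifting type_definition_cabv

lemma variation_sums_nonempty: "variation_sums \<mu> \<noteq> {}"
proof -
  have "(\<Sum>B\<in>{UNIV}. norm (\<mu> B)) \<in> variation_sums \<mu>"
    unfolding variation_sums_def by (intro CollectI exI[of _ "{UNIV}"]) (auto simp: partition_on_def)
  then show ?thesis by blast
qed

lemma bdd_above_variation_sumsI:
  assumes "\<And>P. finite P \<Longrightarrow> P \<subseteq> sets borel \<Longrightarrow> partition_on UNIV P \<Longrightarrow> (\<Sum>B\<in>P. norm (\<mu> B)) \<le> C"
  shows "bdd_above (variation_sums \<mu>)"
  using assms unfolding variation_sums_def by (intro bdd_aboveI[of _ C]) auto

lemma variation_sums_le:
  assumes "bdd_above (variation_sums \<mu>)" "finite P" "P \<subseteq> sets borel" "partition_on UNIV P"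
  shows "(\<Sum>B\<in>P. norm (\<mu> B)) \<le> Sup (variation_sums \<mu>)"
  using assms unfolding variation_sums_def by (intro cSup_upper) auto

lemma Sup_variation_sums_le:
  assumes "\<And>P. finite P \<Longrightarrow> P \<subseteq> sets borel \<Longrightarrow> partition_on UNIV P \<Longrightarrow> (\<Sum>B\<in>P. norm (\<mu> B)) \<le> C"
  shows "Sup (variation_sums \<mu>) \<le> C"
  using variation_sums_nonempty[of \<mu>] assms
  by (intro cSup_least) (auto simp: variation_sums_def)

instantiation cabv :: (topological_space, real_normed_vector) real_normed_vector
begin

lift_definition zero_cabv :: "('a, 'b) cabv" is "\<lambda>_. 0"
  by (auto simp: variation_sums_def)

lift_definition plus_cabv :: "('a, 'b) cabv \<Rightarrow> ('a, 'b) cabv \<Rightarrow> ('a, 'b) cabv"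
  is "\<lambda>\<mu> \<nu> B. \<mu> B + \<nu> B"
proof (safe, goal_cases)
  case (3 \<mu> \<nu>)
  show ?case
  proof (rule bdd_above_variation_sumsI)
    fix P :: "'a set set" assume P: "finite P" "P \<subseteq> sets borel" "partition_on UNIV P"
    have "(\<Sum>B\<in>P. norm (\<mu> B + \<nu> B)) \<le> (\<Sum>B\<in>P. norm (\<mu> B)) + (\<Sum>B\<in>P. norm (\<nu> B))"
      by (simp add: norm_triangle_ineq sum_mono flip: sum.distrib)
    also have "\<dots> \<le> Sup (variation_sums \<mu>) + Sup (variation_sums \<nu>)"
      using 3 P by (intro add_mono variation_sums_le) auto
    finally show "(\<Sum>B\<in>P. norm (\<mu> B + \<nu> B)) \<le> Sup (variation_sums \<mu>) + Sup (variation_sums \<nu>)" .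
  qed
qed (auto intro: sums_add)

lift_definition scaleR_cabv :: "real \<Rightarrow> ('a, 'b) cabv \<Rightarrow> ('a, 'b) cabv"
  is "\<lambda>c \<mu> B. c *\<^sub>R \<mu> B"
proof (safe, goal_cases)
  case (3 c \<mu>)
  show ?case
  proof (rule bdd_above_variation_sumsI)
    fix P :: "'a set set" assume P: "finite P" "P \<subseteq> sets borel" "partition_on UNIV P"
    show "(\<Sum>B\<in>P. norm (c *\<^sub>R \<mu> B)) \<le> \<bar>c\<bar> * Sup (variation_sums \<mu>)"
      using 3 P by (simp add: mult_left_mono variation_sums_le flip: sum_distrib_left)
  qed
qed (auto intro: sums_scaleR_right)

definition uminus_cabv :: "('a, 'b) cabv \<Rightarrow> ('a, 'b) cabv" where "uminus_cabv \<mu> = (- 1) *\<^sub>R \<mu>"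
definition minus_cabv :: "('a, 'b) cabv \<Rightarrow> ('a, 'b) cabv \<Rightarrow> ('a, 'b) cabv"
  where "minus_cabv \<mu> \<nu> = \<mu> + (- \<nu>)"

definition norm_cabv :: "('a, 'b) cabv \<Rightarrow> real" where
  "norm_cabv \<mu> = Sup (variation_sums (cabv_apply \<mu>))"

definition sgn_cabv :: "('a, 'b) cabv \<Rightarrow> ('a, 'b) cabv" where "sgn_cabv \<mu> = inverse (norm \<mu>) *\<^sub>R \<mu>"
definition dist_cabv :: "('a, 'b) cabv \<Rightarrow> ('a, 'b) cabv \<Rightarrow> real" where "dist_cabv \<mu> \<nu> = norm (\<mu> - \<nu>)"
definition uniformity_cabv :: "(('a, 'b) cabv \<times> ('a, 'b) cabv) filter" where
  "uniformity_cabv = (INF e\<in>{0<..}. principal {(x, y). dist x y < e})"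
definition open_cabv :: "('a, 'b) cabv set \<Rightarrow> bool" where
  "open_cabv U \<longleftrightarrow> (\<forall>x\<in>U. eventually (\<lambda>(x', y). x' = x \<longrightarrow> y \<in> U) uniformity)"

lemma bdd_above_variation_sums: "bdd_above (variation_sums (cabv_apply \<mu>))"
  using cabv_apply[of \<mu>] by simp

lemma cabv_apply_empty: "cabv_apply \<mu> {} = 0"
proof -
  have "range (\<lambda>_::nat. {}) \<subseteq> sets borel" "disjoint_family (\<lambda>_::nat. {})"
    by (auto simp: disjoint_family_on_def)
  then have "(\<lambda>_::nat. cabv_apply \<mu> {}) sums cabv_apply \<mu> (\<Union>_::nat. {})"
    using cabv_apply[of \<mu>] by blast
  then show ?thesis using sums_summable summable_LIMSEQ_zero LIMSEQ_const_iff by metis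
qed

lemma norm_cabv_apply_le: "norm (cabv_apply \<mu> B) \<le> norm \<mu>"
proof (cases "B \<in> sets borel \<and> B \<noteq> {}")
  case True
  define P where "P = {B, - B} - {{}}"
  have P: "finite P" "P \<subseteq> sets borel" "partition_on UNIV P" "B \<in> P"
    using True by (auto simp: P_def partition_on_def disjoint_def)
  have "norm (cabv_apply \<mu> B) \<le> (\<Sum>B\<in>P. norm (cabv_apply \<mu> B))"
    using P by (intro member_le_sum) auto
  also have "\<dots> \<le> norm \<mu>"
    unfolding norm_cabv_def using P by (intro variation_sums_le bdd_above_variation_sums)
  finally show ?thesis .
next
  case False
  then have "cabv_apply \<mu> B = 0" using cabv_apply[of \<mu>] cabv_apply_empty[of \<mu>] by auto
  moreover have "0 \<le> Sup (variation_sums (cabv_apply \<mu>))"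
  proof -
    have "0 \<le> (\<Sum>B\<in>{UNIV}. norm (cabv_apply \<mu> B))" by simp
    also have "\<dots> \<le> Sup (variation_sums (cabv_apply \<mu>))"
      by (intro variation_sums_le bdd_above_variation_sums) (auto simp: partition_on_def)
    finally show ?thesis .
  qed
  ultimately show ?thesis by (simp add: norm_cabv_def)
qed

lemma norm_scaleR_cabv_le: "norm (c *\<^sub>R \<mu>) \<le> \<bar>c\<bar> * norm \<mu>" for \<mu> :: "('a, 'b) cabv"
  unfolding norm_cabv_def
proof (rule Sup_variation_sums_le, goal_cases)
  case (1 P)
  then show ?case
    by (simp add: scaleR_cabv.rep_eq mult_left_mono variation_sums_le bdd_above_variation_sums
        flip: sum_distrib_left)
qed

instance
proof
  fix a b :: real and x y z :: "('a, 'b) cabv"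
  show "x + y + z = x + (y + z)" by transfer (simp add: add.assoc)
  show "x + y = y + x" by transfer (simp add: add.commute)
  show "0 + x = x" by transfer simp
  show "- x + x = 0" unfolding uminus_cabv_def by transfer simp
  show "x - y = x + - y" by (rule minus_cabv_def)
  show "a *\<^sub>R (x + y) = a *\<^sub>R x + a *\<^sub>R y" by transfer (simp add: scaleR_add_right)
  show "(a + b) *\<^sub>R x = a *\<^sub>R x + b *\<^sub>R x" by transfer (simp add: scaleR_add_left)
  show one: "1 *\<^sub>R x = x" by transfer simp
  show assoc: "a *\<^sub>R b *\<^sub>R x = (a * b) *\<^sub>R x" for a b by transfer simp
  show "dist x y = norm (x - y)" by (rule dist_cabv_def)
  show "sgn x = inverse (norm x) *\<^sub>R x" by (rule sgn_cabv_def)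
  show "uniformity = (INF e\<in>{0<..}. principal {(x, y :: ('a, 'b) cabv). dist x y < e})"
    by (rule uniformity_cabv_def)
  show "open U \<longleftrightarrow> (\<forall>x\<in>U. \<forall>\<^sub>F (x', y) in uniformity. x' = x \<longrightarrow> y \<in> U)" for U :: "('a, 'b) cabv set"
    by (rule open_cabv_def)
  have norm0: "norm (0 :: ('a, 'b) cabv) \<le> 0"
    unfolding norm_cabv_def by (rule Sup_variation_sums_le) (simp add: zero_cabv.rep_eq)
  have nonneg: "0 \<le> norm x" for x :: "('a, 'b) cabv"
    using norm_cabv_apply_le[of x UNIV] norm_ge_zero order_trans by blast
  show "(norm x = 0) = (x = 0)"
  proof
    assume "norm x = 0"
    then have "cabv_apply x B = 0" for B using norm_cabv_apply_le[of x B] by simp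
    then show "x = 0" by (intro cabv_apply_inject[THEN iffD1]) (auto simp: zero_cabv.rep_eq)
  next
    assume "x = 0"
    then show "norm x = 0" using norm0 nonneg[of 0] by simp
  qed
  show "norm (x + y) \<le> norm x + norm y"
  proof -
    have "Sup (variation_sums (cabv_apply (x + y))) \<le> norm x + norm y"
    proof (rule Sup_variation_sums_le, goal_cases)
      case (1 P)
      have "(\<Sum>B\<in>P. norm (cabv_apply (x + y) B))
          \<le> (\<Sum>B\<in>P. norm (cabv_apply x B)) + (\<Sum>B\<in>P. norm (cabv_apply y B))"
        by (simp add: plus_cabv.rep_eq norm_triangle_ineq sum_mono flip: sum.distrib)
      also have "\<dots> \<le> norm x + norm y"
        unfolding norm_cabv_def using 1 by (intro add_mono variation_sums_le bdd_above_variation_sums)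
      finally show ?case .
    qed
    then show ?thesis by (simp add: norm_cabv_def)
  qed
  show "norm (a *\<^sub>R x) = \<bar>a\<bar> * norm x"
  proof (cases "a = 0")
    case True
    moreover have "0 *\<^sub>R x = 0" by transfer simp
    ultimately show ?thesis using norm0 nonneg[of 0] by simp
  next
    case False
    have "norm x = norm (inverse a *\<^sub>R a *\<^sub>R x)" using False by (simp add: assoc one)
    also have "\<dots> \<le> \<bar>inverse a\<bar> * norm (a *\<^sub>R x)" by (rule norm_scaleR_cabv_le)
    finally have "\<bar>a\<bar> * norm x \<le> norm (a *\<^sub>R x)" using False by (simp add: field_simps)
    then show ?thesis using norm_scaleR_cabv_le[of a x] by simp
  qed
qed

end

text \<open>
  \<open>cabv_image\<close> is the transported measure \<open>h(\<mu>)\<close>, meaningful for continuous \<open>h\<close>;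
  see lemma \<open>cabv_apply_cabv_image\<close>.
\<close>

definition cabv_image ::
    "('t::topological_space \<Rightarrow> 't) \<Rightarrow> ('t, 'x::real_normed_vector) cabv \<Rightarrow> ('t, 'x) cabv" where
  "cabv_image h \<mu> = Abs_cabv (\<lambda>B. if B \<in> sets borel then cabv_apply \<mu> (h -` B) else 0)"

lemma cabv_apply_cabv_image:
  fixes \<mu> :: "('t::topological_space, 'x::real_normed_vector) cabv"
  assumes h: "continuous_on UNIV h" and B: "B \<in> sets borel"
  shows "cabv_apply (cabv_image h \<mu>) B = cabv_apply \<mu> (h -` B)"
proof -
  have meas: "h -` C \<in> sets borel" if "C \<in> sets borel" for C
    using measurable_sets[OF borel_measurable_continuous_onI[OF h] that] by simp
  let ?m = "\<lambda>B. if B \<in> sets borel then cabv_apply \<mu> (h -` B) else 0"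
  have "(\<lambda>i. ?m (A i)) sums ?m (\<Union>i. A i)"
    if A: "range A \<subseteq> sets borel" "disjoint_family A" for A :: "nat \<Rightarrow> 't set"
  proof -
    have "range (\<lambda>i. h -` A i) \<subseteq> sets borel" "disjoint_family (\<lambda>i. h -` A i)"
      using A meas by (auto simp: disjoint_family_on_def)
    then have "(\<lambda>i. cabv_apply \<mu> (h -` A i)) sums cabv_apply \<mu> (\<Union>i. h -` A i)"
      using cabv_apply[of \<mu>] by blast
    moreover have "A i \<in> sets borel" for i using A by auto
    ultimately show ?thesis by (simp add: vimage_UN)
  qed
  moreover have "bdd_above (variation_sums ?m)"
  proof (rule bdd_above_variation_sumsI)
    fix P :: "'t set set" assume P: "finite P" "P \<subseteq> sets borel" "partition_on UNIV P"
    define Q where "Q = (\<lambda>B. h -` B) ` P - {{}}"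
    have PD: "B \<inter> C = {}" if "B \<in> P" "C \<in> P" "B \<noteq> C" for B C
      using P(3) that unfolding partition_on_def disjoint_def by blast
    have "\<Union>Q = h -` \<Union>P" by (auto simp: Q_def)
    moreover have "disjoint Q"
      unfolding disjoint_def
    proof (intro ballI impI)
      fix C D assume CD: "C \<in> Q" "D \<in> Q" "C \<noteq> D"
      obtain B B' where B: "C = h -` B" "D = h -` B'" "B \<in> P" "B' \<in> P"
        using CD(1,2) unfolding Q_def by blast
      moreover have "B \<noteq> B'" using B(1,2) CD(3) by blast
      ultimately show "C \<inter> D = {}" using PD[of B B'] by auto
    qed
    ultimately have Q: "finite Q" "Q \<subseteq> sets borel" "partition_on UNIV Q"
      using P meas by (auto simp: Q_def partition_on_def)
    have ne: "h -` B \<noteq> h -` C \<or> h -` B = {}" if "B \<in> P" "C \<in> P" "B \<noteq> C" for B C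
      using PD[OF that] by auto
    have "(\<Sum>B\<in>P. norm (?m B)) = (\<Sum>B\<in>P. norm (cabv_apply \<mu> (h -` B)))"
      using P by (intro sum.cong) auto
    also have "\<dots> = (\<Sum>B\<in>{B\<in>P. h -` B \<noteq> {}}. norm (cabv_apply \<mu> (h -` B)))"
      using P by (intro sum.mono_neutral_right) (auto simp: cabv_apply_empty)
    also have "\<dots> = (\<Sum>C\<in>Q. norm (cabv_apply \<mu> C))"
    proof (intro sum.reindex_cong[symmetric, of "\<lambda>B. h -` B"])
      show "inj_on (\<lambda>B. h -` B) {B\<in>P. h -` B \<noteq> {}}" using ne by (auto simp: inj_on_def)
      show "Q = (\<lambda>B. h -` B) ` {B\<in>P. h -` B \<noteq> {}}" unfolding Q_def by blast
    qed simp
    also have "\<dots> \<le> norm \<mu>"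
      unfolding norm_cabv_def using Q by (intro variation_sums_le bdd_above_variation_sums)
    finally show "(\<Sum>B\<in>P. norm (?m B)) \<le> norm \<mu>" .
  qed
  ultimately have "cabv_apply (cabv_image h \<mu>) = ?m"
    unfolding cabv_image_def by (intro Abs_cabv_inverse) auto
  with B show ?thesis by simp
qed

lift_definition cabv_op ::
    "('x::real_normed_vector \<Rightarrow>\<^sub>L 'y::real_normed_vector) \<Rightarrow> ('t::topological_space, 'x) cabv
      \<Rightarrow> ('t, 'y) cabv"
  is "\<lambda>R \<mu> B. R (\<mu> B)"
proof (safe, goal_cases)
  case (3 R \<mu>)
  show ?case
  proof (rule bdd_above_variation_sumsI)
    fix P :: "'t set set" assume P: "finite P" "P \<subseteq> sets borel" "partition_on UNIV P"
    have "(\<Sum>B\<in>P. norm (R (\<mu> B))) \<le> onorm R * (\<Sum>B\<in>P. norm (\<mu> B))"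
      using 3 by (auto simp: sum_distrib_left intro!: sum_mono onorm)
    also have "\<dots> \<le> onorm R * Sup (variation_sums \<mu>)"
      using 3 P by (intro mult_left_mono variation_sums_le onorm_pos_le) auto
    finally show "(\<Sum>B\<in>P. norm (R (\<mu> B))) \<le> onorm R * Sup (variation_sums \<mu>)" .
  qed
next
  case (1 R \<mu> B)
  then show ?case by (simp add: linear_simps)
next
  case (2 R \<mu> A)
  then show ?case by (intro bounded_linear.sums[of R]) auto
qed

text \<open>The infinite sum is the limit in the variational norm, the norm of \<open>cabv\<close>.\<close>

definition H_op ::
    "(nat \<Rightarrow> 'x::real_normed_vector \<Rightarrow>\<^sub>L 'x) \<Rightarrow> (nat \<Rightarrow> 't::topological_space \<Rightarrow> 't)
      \<Rightarrow> ('t, 'x) cabv \<Rightarrow> ('t, 'x) cabv" where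
  "H_op R \<omega> \<mu> = (\<Sum>i. cabv_op (R i) (cabv_image (\<omega> i) \<mu>))"

definition simple_cabv_integral ::
    "('t::topological_space \<Rightarrow> 'k::real_or_complex ^ 'n) \<Rightarrow> ('t, 'k ^ 'n) cabv \<Rightarrow> 'k" where
  "simple_cabv_integral f \<mu> = (\<Sum>x\<in>range f. scalar_prod x (cabv_apply \<mu> (f -` {x})))"

text \<open>
  The limit exists and does not depend on the choice of the approximating sequence, since \<open>simple_cabv_integral\<close> is additive in \<open>f\<close> and bounded by
  the sup norm of \<open>f\<close> times \<open>norm \<mu>\<close>.
\<close>

definition cabv_integral ::
    "('t::topological_space \<Rightarrow> 'k::real_or_complex ^ 'n) \<Rightarrow> ('t, 'k ^ 'n) cabv \<Rightarrow> 'k" where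
  "cabv_integral f \<mu> =
     (THE I. \<exists>s. (\<forall>m. simple_function borel (s m)) \<and> uniform_limit UNIV s f sequentially \<and>
        (\<lambda>m. simple_cabv_integral (s m) \<mu>) \<longlonglongrightarrow> I)"

definition BL_norm :: "('t::metric_space \<Rightarrow> 'x::real_normed_vector) \<Rightarrow> ennreal" where
  "BL_norm f = (SUP t. ennreal (norm (f t))) + lip_const f"

definition MK_norm :: "('t::metric_space, 'k::real_or_complex ^ 'n) cabv \<Rightarrow> real" where
  "MK_norm \<mu> = Sup {norm (cabv_integral f \<mu>) | f. f \<in> Lip \<and> BL_norm f \<le> 1}"

definition MK_dist ::
    "('t::metric_space, 'k::real_or_complex ^ 'n) cabv \<Rightarrow> ('t, 'k ^ 'n) cabv \<Rightarrow> real" where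
  "MK_dist \<mu> \<nu> = MK_norm (\<mu> - \<nu>)"

definition weak_star :: "('t::metric_space, 'k::real_or_complex ^ 'n) cabv topology" where
  "weak_star =
     topology_generated_by {{\<mu>. cabv_integral f \<mu> \<in> U} | f U. continuous_on UNIV f \<and> open U}"

end

theory Submission
  imports Defs
begin

text \<open>
  The number \<open>d\<close> controls the map \<open>H\<^sub>2\<close> in two norms at once. In the Monge-Kantorovich norm,
  integrating a test function against \<open>R\<^sub>i \<circ> \<omega>\<^sub>i(\<mu>)\<close> is the same as integrating \<open>R\<^sub>i\<^sup>* \<circ> f \<circ> \<omega>\<^sub>i\<close>
  against \<open>\<mu>\<close>, and this function has bounded Lipschitz norm at most \<open>\<parallel>R\<^sub>i\<parallel> (1 + r\<^sub>i)\<close> if \<open>f\<close> has norm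
  at most 1; summing over \<open>i\<close> gives the factor \<open>d\<close> (lemma \<open>MK_norm_H_op_le\<close>).

  In the variation norm the factor is \<open>\<Sum>\<parallel>R\<^sub>i\<parallel>\<close> (lemma \<open>norm_H_op_le\<close>), because transporting a measure
  does not increase its variation. Since \<open>\<Sum>\<parallel>R\<^sub>i\<parallel> \<le> d < 1\<close>, the map is a contraction for the variation
  norm as well. The measures form a Banach space for that norm, and a weak* closed set is closed in it,
  integration against a continuous function being a bounded functional. The fixed point
  therefore comes from the Banach fixed point theorem for the variation norm. If \<open>\<mu>\<^sup>0 = 0\<close>, the fixed point
  satisfies \<open>\<parallel>\<mu>\<parallel> \<le> (\<Sum>\<parallel>R\<^sub>i\<parallel>) \<parallel>\<mu>\<parallel>\<close>, so it is 0, and 0 lies in \<open>A\<close>.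

  That \<open>B\<^sub>a\<close> is an admissible \<open>A\<close> needs its weak* closedness. It is an intersection of
  weak* closed conditions \<open>\<bar>\<integral>f d\<mu>\<bar> \<le> a\<close>, one for each continuous \<open>f\<close> with values in the unit ball, once
  the variation is known to be the dual norm (lemma \<open>norm_cabv_le_if_integrals_le\<close>). This rests on
  the variation measure and its regularity: a simple function that nearly realises the variation
  agrees with a continuous one outside a set of small variation.
\<close>

section \<open>The scalar product and adjoints\<close>

text \<open>
  The scalars are not assumed complete, but by the classification of the class they
  are a copy of the reals or of the complex numbers. Completeness is what makes absolutely
  convergent series of measures converge.
\<close>

instance real_or_complex \<subseteq> banach
proof
  fix X :: "nat \<Rightarrow> 'a" assume X: "Cauchy X"
  have transport: "convergent X"
    if \<phi>: "bij \<phi>" "\<And>x y. \<phi> (x + y) = \<phi> x + \<phi> y" "\<And>x. norm (\<phi> x) = norm x"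
    for \<phi> :: "'b::banach \<Rightarrow> 'a"
  proof -
    interpret additive \<phi> by standard (rule \<phi>(2))
    have dist_\<phi>: "dist (\<phi> x) (\<phi> y) = dist x y" for x y
      by (simp add: dist_norm \<phi>(3) flip: diff)
    define Y where "Y n = inv \<phi> (X n)" for n
    have XY: "X = (\<lambda>n. \<phi> (Y n))" using \<phi>(1) by (auto simp: Y_def bij_is_surj surj_f_inv_f)
    have "Cauchy Y" using X unfolding XY by (simp add: Cauchy_def dist_\<phi>)
    then obtain l where "Y \<longlonglongrightarrow> l" using Cauchy_convergent convergentD by blast
    then have "X \<longlonglongrightarrow> \<phi> l" unfolding XY by (simp add: tendsto_iff dist_\<phi>)
    then show ?thesis by (rule convergentI)
  qed
  show "convergent X"
    using real_or_complex_cases[where 'a = 'a] transport by metis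
qed

lemma norm_conjg: "norm (conjg x) = norm x" for x :: "'k::real_or_complex"
proof (cases "x = 0")
  case True
  then show ?thesis using conjg_of_real[of 0, where 'a = 'k] by simp
next
  case False
  have "norm x * norm (conjg x) = norm x * norm x"
    by (simp add: mult_conjg power2_eq_square flip: norm_mult)
  with False show ?thesis by simp
qed

lemma conjg_mult: "conjg (x * y) = conjg x * conjg y" for x y :: "'k::real_or_complex"
proof (cases "x * y = 0")
  case True
  then show ?thesis using conjg_of_real[of 0, where 'a = 'k] by auto
next
  case False
  have "(x * y) * conjg (x * y) = (x * conjg x) * (y * conjg y)"
    by (simp only: mult_conjg norm_mult power_mult_distrib of_real_mult)
  then have "(x * y) * conjg (x * y) = (x * y) * (conjg x * conjg y)"
    by (simp add: mult_ac)
  with False show ?thesis by simp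
qed

lemma conjg_scaleR: "conjg (c *\<^sub>R x) = c *\<^sub>R conjg (x :: 'k::real_or_complex)"
  by (simp add: scaleR_conv_of_real conjg_mult conjg_of_real)

lemma norm_scalar_prod_le: "norm (scalar_prod x y) \<le> norm x * norm y"
proof -
  have "norm (scalar_prod x y) \<le> (\<Sum>i\<in>UNIV. norm (x $ i) * norm (y $ i))"
    unfolding scalar_prod_def
    by (rule order_trans[OF norm_sum]) (simp add: norm_mult norm_conjg)
  also have "\<dots> \<le> norm x * norm y"
    using L2_set_mult_ineq[of "\<lambda>i. norm (x $ i)" "\<lambda>i. norm (y $ i)" UNIV]
    by (simp add: norm_vec_def)
  finally show ?thesis .
qed

lemma scalar_prod_self: "scalar_prod x x = of_real ((norm x)\<^sup>2)"
  by (simp add: scalar_prod_def mult_conjg norm_vec_def L2_set_def sum_nonneg real_sqrt_pow2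
      del: of_real_power flip: of_real_sum)

lemma bounded_bilinear_scalar_prod: "bounded_bilinear scalar_prod"
proof
  show "scalar_prod (x + y) z = scalar_prod x z + scalar_prod y z" for x y z :: "'a ^ 'b"
    by (simp add: scalar_prod_def algebra_simps sum.distrib)
  show "scalar_prod z (x + y) = scalar_prod z x + scalar_prod z y" for x y z :: "'a ^ 'b"
    by (simp add: scalar_prod_def conjg_add algebra_simps sum.distrib)
  show "scalar_prod (c *\<^sub>R x) y = c *\<^sub>R scalar_prod x y" for c and x y :: "'a ^ 'b"
    by (simp add: scalar_prod_def scaleR_sum_right)
  show "scalar_prod x (c *\<^sub>R y) = c *\<^sub>R scalar_prod x y" for c and x y :: "'a ^ 'b"
    by (simp add: scalar_prod_def conjg_scaleR scaleR_sum_right)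
  show "\<exists>K. \<forall>x y :: 'a ^ 'b. norm (scalar_prod x y) \<le> norm x * norm y * K"
    using norm_scalar_prod_le by (metis mult.right_neutral)
qed

interpretation scalar_prod: bounded_bilinear scalar_prod
  by (rule bounded_bilinear_scalar_prod)

text \<open>
  The conjugate transpose of the matrix of \<open>R\<close>, read off from the images of the unit vectors.
  This is the adjoint if \<open>R\<close> is linear over the scalars; real linearity would not suffice.
\<close>

definition adjoint_op ::
    "('k::real_or_complex ^ 'n \<Rightarrow> 'k ^ 'n) \<Rightarrow> 'k ^ 'n \<Rightarrow> 'k ^ 'n" where
  "adjoint_op R x = (\<chi> j. scalar_prod x (R (axis j 1)))"

lemma scalar_prod_adjoint_op:
  fixes R :: "'k::real_or_complex ^ 'n \<Rightarrow> 'k ^ 'n"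
  assumes "Vector_Spaces.linear (*s) (*s) R"
  shows "scalar_prod (adjoint_op R x) y = scalar_prod x (R y)"
proof -
  interpret R: Vector_Spaces.linear "(*s)" "(*s)" R by (rule assms)
  have "R y = R (\<Sum>j\<in>UNIV. y $ j *s axis j 1)" by (simp add: basis_expansion)
  also have "\<dots> = (\<Sum>j\<in>UNIV. y $ j *s R (axis j 1))" by (simp add: R.sum R.scale)
  finally have "scalar_prod x (R y) = (\<Sum>j\<in>UNIV. scalar_prod x (y $ j *s R (axis j 1)))"
    by (simp add: scalar_prod.sum_right)
  also have "\<dots> = scalar_prod (adjoint_op R x) y"
    by (simp add: scalar_prod_def adjoint_op_def conjg_mult sum_distrib_left mult_ac)
  finally show ?thesis ..
qed

lemma adjoint_op_diff: "adjoint_op R x - adjoint_op R y = adjoint_op R (x - y)"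
  by (simp add: adjoint_op_def vec_eq_iff scalar_prod.diff_left)

lemma norm_adjoint_op_le:
  fixes R :: "('k::real_or_complex ^ 'n) \<Rightarrow>\<^sub>L ('k ^ 'n)"
  assumes "Vector_Spaces.linear (*s) (*s) (blinfun_apply R)"
  shows "norm (adjoint_op (blinfun_apply R) x) \<le> norm R * norm x"
proof -
  let ?y = "adjoint_op (blinfun_apply R) x"
  have "(norm ?y)\<^sup>2 = norm (scalar_prod ?y ?y)" 
    by (simp add: scalar_prod_self norm_of_real del: of_real_power)
  also have "\<dots> = norm (scalar_prod x (R ?y))" by (simp add: scalar_prod_adjoint_op[OF assms])
  also have "\<dots> \<le> norm x * norm (R ?y)" by (rule norm_scalar_prod_le)
  also have "\<dots> \<le> norm x * (norm R * norm ?y)" by (intro mult_left_mono norm_blinfun) simp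
  finally have "norm ?y * norm ?y \<le> (norm R * norm x) * norm ?y"
    by (simp add: power2_eq_square mult_ac)
  then show ?thesis by (cases "?y = 0") auto
qed

section \<open>The Banach space of vector measures\<close>

lemma cabv_apply_sums:
  "range B \<subseteq> sets borel \<Longrightarrow> disjoint_family B \<Longrightarrow>
    (\<lambda>i. cabv_apply \<mu> (B i)) sums cabv_apply \<mu> (\<Union>i. B i)"
  by (rule cabv_apply[unfolded mem_Collect_eq, THEN conjunct2, THEN conjunct1, rule_format])

lemma cabv_apply_not_borel: "B \<notin> sets borel \<Longrightarrow> cabv_apply \<mu> B = 0"
  by (rule cabv_apply[unfolded mem_Collect_eq, THEN conjunct1, rule_format])

lemma uminus_cabv_rep_eq: "cabv_apply (- \<mu>) B = - cabv_apply \<mu> B"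
  unfolding uminus_cabv_def scaleR_cabv.rep_eq by simp

lemma minus_cabv_rep_eq: "cabv_apply (\<mu> - \<nu>) B = cabv_apply \<mu> B - cabv_apply \<nu> B"
  unfolding minus_cabv_def plus_cabv.rep_eq uminus_cabv_rep_eq by simp

lemma cabv_eqI: "(\<And>B. B \<in> sets borel \<Longrightarrow> cabv_apply \<mu> B = cabv_apply \<nu> B) \<Longrightarrow> \<mu> = \<nu>"
  by (rule cabv_apply_inject[THEN iffD1], rule ext, case_tac "x \<in> sets borel")
    (simp_all add: cabv_apply_not_borel)

lemma Union_Diff_empty: "\<Union>(\<S> - {{}}) = \<Union>\<S>"
  by blast

lemma partition_of_disjoint_family:
  assumes "finite I" "disjoint_family_on A I" "\<And>i. i \<in> I \<Longrightarrow> A i \<in> sets borel"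
  defines "P \<equiv> insert (- (\<Union>i\<in>I. A i)) (A ` I) - {{}}"
  shows "finite P" "P \<subseteq> sets borel" "partition_on UNIV P"
    "A ` {i\<in>I. A i \<noteq> {}} \<subseteq> P" "inj_on A {i\<in>I. A i \<noteq> {}}"
proof -
  have disj: "A i \<inter> A j = {}" if "i \<in> I" "j \<in> I" "A i \<noteq> A j" for i j
    using assms(2) that by (metis disjoint_family_on_def)
  show "finite P" using assms(1) by (simp add: P_def)
  show "A ` {i\<in>I. A i \<noteq> {}} \<subseteq> P" by (auto simp: P_def)
  have "(\<Union>i\<in>I. A i) \<in> sets borel" using assms(1,3) by (intro sets.finite_UN) auto
  then have "- (\<Union>i\<in>I. A i) \<in> sets borel" by (rule borel_comp)
  then show "P \<subseteq> sets borel" using assms(3) by (auto simp only: P_def)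
  have "disjoint P"
    unfolding disjoint_def P_def
  proof (intro ballI impI)
    fix B C assume "B \<in> insert (- (\<Union>i\<in>I. A i)) (A ` I) - {{}}"
      "C \<in> insert (- (\<Union>i\<in>I. A i)) (A ` I) - {{}}" "B \<noteq> C"
    then consider "B = - (\<Union>i\<in>I. A i)" "C \<in> A ` I" | "C = - (\<Union>i\<in>I. A i)" "B \<in> A ` I"
      | "B \<in> A ` I" "C \<in> A ` I" by blast
    then show "B \<inter> C = {}"
    proof cases
      case 3
      then obtain i j where "i \<in> I" "j \<in> I" "B = A i" "C = A j" by blast
      with disj \<open>B \<noteq> C\<close> show ?thesis by simp
    qed blast+
  qed
  moreover have "\<Union>P = UNIV"
  proof -
    have "\<Union>P = - (\<Union>i\<in>I. A i) \<union> (\<Union>i\<in>I. A i)"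
      unfolding P_def Union_Diff_empty by (simp only: Union_insert)
    then show ?thesis by (simp only: Compl_partition2)
  qed
  moreover have "{} \<notin> P" by (simp add: P_def)
  ultimately show "partition_on UNIV P" unfolding partition_on_def by blast
  show "inj_on A {i\<in>I. A i \<noteq> {}}"
  proof (rule inj_onI)
    fix i j assume ij: "i \<in> {i\<in>I. A i \<noteq> {}}" "j \<in> {i\<in>I. A i \<noteq> {}}" "A i = A j"
    show "i = j"
    proof (rule ccontr)
      assume "i \<noteq> j"
      then have "A i \<inter> A j = {}" using assms(2) ij(1,2) unfolding disjoint_family_on_def by blast
      with ij show False by simp
    qed
  qed
qed

text \<open>
  Dropping empty members and adding the complement of the union turns a disjoint family into
  a partition. Indexed families, with repeated empty members allowed, are what intersections
  and preimages produce.
\<close>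

lemma sum_norm_cabv_le:
  assumes "finite I" "disjoint_family_on A I" "\<And>i. i \<in> I \<Longrightarrow> A i \<in> sets borel"
  shows "(\<Sum>i\<in>I. norm (cabv_apply \<mu> (A i))) \<le> norm \<mu>"
proof -
  let ?P = "insert (- (\<Union>i\<in>I. A i)) (A ` I) - {{}}"
  note P = partition_of_disjoint_family[OF assms]
  have "(\<Sum>i\<in>I. norm (cabv_apply \<mu> (A i)))
      = (\<Sum>i\<in>{i\<in>I. A i \<noteq> {}}. norm (cabv_apply \<mu> (A i)))"
    using assms(1) by (intro sum.mono_neutral_right) (auto simp: cabv_apply_empty)
  also have "\<dots> = (\<Sum>B\<in>A ` {i\<in>I. A i \<noteq> {}}. norm (cabv_apply \<mu> B))"
    by (simp add: sum.reindex[OF P(5)])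
  also have "\<dots> \<le> (\<Sum>B\<in>?P. norm (cabv_apply \<mu> B))"
    using P(1,4) by (intro sum_mono2) auto
  also have "\<dots> \<le> norm \<mu>"
    unfolding norm_cabv_def using P by (intro variation_sums_le bdd_above_variation_sums)
  finally show ?thesis .
qed

lemma norm_cabv_leI:
  assumes "\<And>P. finite P \<Longrightarrow> P \<subseteq> sets borel \<Longrightarrow> partition_on UNIV P \<Longrightarrow>
      (\<Sum>B\<in>P. norm (cabv_apply \<mu> B)) \<le> C"
  shows "norm \<mu> \<le> C"
  unfolding norm_cabv_def by (rule Sup_variation_sums_le) (rule assms)

lemma disjoint_family_on_partition: "partition_on S P \<Longrightarrow> disjoint_family_on (\<lambda>B. B) P"
  by (auto simp: partition_on_def disjoint_family_on_def disjoint_def)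

lemma cabv_apply_UN:
  assumes "finite I" "disjoint_family_on A I" "\<And>i. i \<in> I \<Longrightarrow> A i \<in> sets borel"
  shows "cabv_apply \<mu> (\<Union>i\<in>I. A i) = (\<Sum>i\<in>I. cabv_apply \<mu> (A i))"
proof -
  have *: "cabv_apply \<mu> (A \<union> B) = cabv_apply \<mu> A + cabv_apply \<mu> B"
    if "A \<in> sets borel" "B \<in> sets borel" "A \<inter> B = {}" for A B
  proof -
    have "(\<lambda>i. cabv_apply \<mu> (binaryset A B i)) sums cabv_apply \<mu> (\<Union>i. binaryset A B i)"
    proof (rule cabv_apply_sums)
      show "range (binaryset A B) \<subseteq> sets borel" using that by (simp add: range_binaryset_eq)
      show "disjoint_family (binaryset A B)"
        using that by (auto simp: disjoint_family_on_def binaryset_def)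
    qed
    moreover have "(\<lambda>i. cabv_apply \<mu> (binaryset A B i)) sums (cabv_apply \<mu> A + cabv_apply \<mu> B)"
      by (intro binaryset_sums) (rule cabv_apply_empty)
    ultimately show ?thesis by (simp add: UN_binaryset_eq sums_unique2)
  qed
  show ?thesis using assms
  proof (induction I)
    case (insert i I)
    then have "cabv_apply \<mu> (A i \<union> (\<Union>i\<in>I. A i)) = cabv_apply \<mu> (A i) + cabv_apply \<mu> (\<Union>i\<in>I. A i)"
      by (intro *) (auto simp: disjoint_family_on_def)
    moreover have "cabv_apply \<mu> (\<Union>i\<in>I. A i) = (\<Sum>i\<in>I. cabv_apply \<mu> (A i))"
      using insert by (intro insert.IH) (auto simp: disjoint_family_on_def)
    ultimately show ?case using insert by simp
  qed (simp add: cabv_apply_empty)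
qed

text \<open>
  A Cauchy sequence for the variation converges on every Borel set. Since the variation
  controls sums over disjoint families, the convergence is uniform over such families,
  which carries \<open>\<sigma>\<close>-additivity and finite variation over to the limit.
\<close>

instance cabv :: (topological_space, banach) banach
proof
  fix X :: "nat \<Rightarrow> ('a, 'b) cabv" assume X: "Cauchy X"
  define L where "L B = lim (\<lambda>n. cabv_apply (X n) B)" for B
  have L: "(\<lambda>n. cabv_apply (X n) B) \<longlonglongrightarrow> L B" for B
  proof -
    have "Cauchy (\<lambda>n. cabv_apply (X n) B)"
    proof (rule CauchyI)
      fix e :: real assume "0 < e"
      then obtain N where N: "\<And>m n. N \<le> m \<Longrightarrow> N \<le> n \<Longrightarrow> norm (X m - X n) < e"
        using CauchyD[OF X] by blast
      have "norm (cabv_apply (X m) B - cabv_apply (X n) B) < e" if "N \<le> m" "N \<le> n" for m n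
        using N[OF that] norm_cabv_apply_le[of "X m - X n" B] by (simp add: minus_cabv_rep_eq)
      then show "\<exists>M. \<forall>m\<ge>M. \<forall>n\<ge>M. norm (cabv_apply (X m) B - cabv_apply (X n) B) < e" by blast
    qed
    then show ?thesis
      unfolding L_def using Cauchy_convergent convergent_LIMSEQ_iff by blast
  qed
  \<comment> \<open>The threshold \<open>N\<close> must not depend on the family: this is what the variation norm gives.\<close>
  have uniform: "\<exists>N. \<forall>n\<ge>N. \<forall>(I :: 'i set) A. finite I \<longrightarrow> disjoint_family_on A I \<longrightarrow> A ` I \<subseteq> sets borel \<longrightarrow>
      (\<Sum>i\<in>I. norm (cabv_apply (X n) (A i) - L (A i))) \<le> e"
    if "0 < e" for e :: real
  proof -
    obtain N where N: "norm (X n - X m) < e" if "N \<le> n" "N \<le> m" for n m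
      using CauchyD[OF X \<open>0 < e\<close>] by blast
    have bound: "(\<Sum>i\<in>I. norm (cabv_apply (X n) (A i) - L (A i))) \<le> e"
      if n: "N \<le> n" and A: "finite I" "disjoint_family_on A I" "A ` I \<subseteq> sets borel"
      for n I and A :: "'i \<Rightarrow> 'a set"
    proof (rule LIMSEQ_le_const2)
      show "(\<lambda>m. \<Sum>i\<in>I. norm (cabv_apply (X n) (A i) - cabv_apply (X m) (A i)))
          \<longlonglongrightarrow> (\<Sum>i\<in>I. norm (cabv_apply (X n) (A i) - L (A i)))"
        by (intro tendsto_intros L)
      show "\<exists>M. \<forall>m\<ge>M. (\<Sum>i\<in>I. norm (cabv_apply (X n) (A i) - cabv_apply (X m) (A i))) \<le> e"
      proof (intro exI[of _ N] allI impI)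
        fix m assume "N \<le> m"
        have "(\<Sum>i\<in>I. norm (cabv_apply (X n - X m) (A i))) \<le> norm (X n - X m)"
          using A by (intro sum_norm_cabv_le) auto
        also have "\<dots> \<le> e" using N[OF n \<open>N \<le> m\<close>] by simp
        finally show "(\<Sum>i\<in>I. norm (cabv_apply (X n) (A i) - cabv_apply (X m) (A i))) \<le> e"
          by (simp add: minus_cabv_rep_eq)
      qed
    qed
    show ?thesis by (intro exI[of _ N] allI impI bound)
  qed
  have sums: "(\<lambda>i. L (B i)) sums L (\<Union>i. B i)"
    if B: "range B \<subseteq> sets borel" "disjoint_family B" for B :: "nat \<Rightarrow> 'a set"
    unfolding sums_def
  proof (rule LIMSEQ_I)
    fix e :: real assume "0 < e"
    have "0 < e / 4" using \<open>0 < e\<close> by simp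
    obtain N where N: "\<forall>n\<ge>N. \<forall>(I :: nat set) A. finite I \<longrightarrow> disjoint_family_on A I \<longrightarrow>
        A ` I \<subseteq> sets borel \<longrightarrow>
        (\<Sum>i\<in>I. norm (cabv_apply (X n) (A i) - L (A i))) \<le> e / 4"
      using uniform[OF \<open>0 < e / 4\<close>] by (rule exE)
    note N = N[rule_format, OF order_refl]
    have "(\<Sum>i\<in>{0::nat}. norm (cabv_apply (X N) (\<Union>i. B i) - L (\<Union>i. B i))) \<le> e / 4"
      using B by (intro N) (auto simp: disjoint_family_on_def)
    then have 1: "norm (cabv_apply (X N) (\<Union>i. B i) - L (\<Union>i. B i)) \<le> e / 4" by simp
    have 2: "norm ((\<Sum>i<k. cabv_apply (X N) (B i)) - (\<Sum>i<k. L (B i))) \<le> e / 4" for k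
    proof -
      have "norm ((\<Sum>i<k. cabv_apply (X N) (B i)) - (\<Sum>i<k. L (B i)))
          \<le> (\<Sum>i<k. norm (cabv_apply (X N) (B i) - L (B i)))"
        by (simp add: norm_sum flip: sum_subtractf)
      also have "\<dots> \<le> e / 4"
        using B by (intro N) (auto simp: disjoint_family_on_def)
      finally show ?thesis .
    qed
    have "(\<lambda>k. \<Sum>i<k. cabv_apply (X N) (B i)) \<longlonglongrightarrow> cabv_apply (X N) (\<Union>i. B i)"
      using cabv_apply_sums[OF B] by (simp add: sums_def)
    then obtain M where M: "\<And>k. M \<le> k \<Longrightarrow>
        norm ((\<Sum>i<k. cabv_apply (X N) (B i)) - cabv_apply (X N) (\<Union>i. B i)) < e / 4"
      using LIMSEQ_D[OF _ \<open>0 < e / 4\<close>] by blast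
    have "norm ((\<Sum>i<k. L (B i)) - L (\<Union>i. B i)) < e" if "M \<le> k" for k
    proof -
      let ?x = "\<Sum>i<k. cabv_apply (X N) (B i)" and ?y = "cabv_apply (X N) (\<Union>i. B i)"
      have "(\<Sum>i<k. L (B i)) - L (\<Union>i. B i)
          = (?y - L (\<Union>i. B i)) + (?x - ?y) - (?x - (\<Sum>i<k. L (B i)))" by simp
      then have "norm ((\<Sum>i<k. L (B i)) - L (\<Union>i. B i))
          \<le> norm (?y - L (\<Union>i. B i)) + norm (?x - ?y) + norm (?x - (\<Sum>i<k. L (B i)))"
        using norm_triangle_ineq4[of "(?y - L (\<Union>i. B i)) + (?x - ?y)" "?x - (\<Sum>i<k. L (B i))"]
          norm_triangle_ineq[of "?y - L (\<Union>i. B i)" "?x - ?y"] by simp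
      then show ?thesis using 1 2[of k] M[OF that] \<open>0 < e\<close> by linarith
    qed
    then show "\<exists>M. \<forall>k\<ge>M. norm ((\<Sum>i<k. L (B i)) - L (\<Union>i. B i)) < e" by blast
  qed
  have "bdd_above (variation_sums L)"
  proof -
    obtain N where N: "\<forall>n\<ge>N. \<forall>(I :: 'a set set) A. finite I \<longrightarrow> disjoint_family_on A I \<longrightarrow>
        A ` I \<subseteq> sets borel \<longrightarrow>
        (\<Sum>i\<in>I. norm (cabv_apply (X n) (A i) - L (A i))) \<le> 1"
      using uniform[OF zero_less_one] by (rule exE)
    note N = N[rule_format, OF order_refl]
    show ?thesis
    proof (rule bdd_above_variation_sumsI)
      fix P :: "'a set set" assume P: "finite P" "P \<subseteq> sets borel" "partition_on UNIV P"
      have "(\<Sum>B\<in>P. norm (L B))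
          \<le> (\<Sum>B\<in>P. norm (cabv_apply (X N) B) + norm (cabv_apply (X N) B - L B))"
        by (intro sum_mono) (metis norm_triangle_sub norm_minus_commute)
      also have "\<dots> \<le> norm (X N) + 1"
        using sum_norm_cabv_le[of P "\<lambda>B. B" "X N"] N[of P "\<lambda>B. B"] P
          disjoint_family_on_partition[OF P(3)] by (simp add: sum.distrib subset_iff)
      finally show "(\<Sum>B\<in>P. norm (L B)) \<le> norm (X N) + 1" .
    qed
  qed
  moreover have "L B = 0" if "B \<notin> sets borel" for B
    using L[of B] that by (simp add: cabv_apply_not_borel LIMSEQ_const_iff)
  ultimately have rep: "cabv_apply (Abs_cabv L) = L"
    using sums by (intro Abs_cabv_inverse) blast
  have "X \<longlonglongrightarrow> Abs_cabv L"
  proof (rule LIMSEQ_I)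
    fix e :: real assume "0 < e"
    have "0 < e / 2" using \<open>0 < e\<close> by simp
    obtain N where N: "\<forall>n\<ge>N. \<forall>(I :: 'a set set) A. finite I \<longrightarrow> disjoint_family_on A I \<longrightarrow>
        A ` I \<subseteq> sets borel \<longrightarrow>
        (\<Sum>i\<in>I. norm (cabv_apply (X n) (A i) - L (A i))) \<le> e / 2"
      using uniform[OF \<open>0 < e / 2\<close>] by (rule exE)
    note N = N[rule_format]
    have "norm (X n - Abs_cabv L) \<le> e / 2" if "N \<le> n" for n
    proof (rule norm_cabv_leI)
      fix P :: "'a set set" assume P: "finite P" "P \<subseteq> sets borel" "partition_on UNIV P"
      show "(\<Sum>B\<in>P. norm (cabv_apply (X n - Abs_cabv L) B)) \<le> e / 2"
        using N[OF that, of P "\<lambda>B. B"] P disjoint_family_on_partition[OF P(3)]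
        by (simp add: minus_cabv_rep_eq rep)
    qed
    then show "\<exists>N. \<forall>n\<ge>N. norm (X n - Abs_cabv L) < e"
      using \<open>0 < e\<close> by (intro exI[of _ N] allI impI) (fastforce intro: le_less_trans)
  qed
  then show "convergent X" by (rule convergentI)
qed

section \<open>The variation measure and its regularity\<close>

text \<open>
  The supremum runs over disjoint families inside \<open>E\<close> and not only over partitions of \<open>E\<close>, which
  gives the same value and makes monotonicity in \<open>E\<close> immediate.
\<close>

definition cabv_variation ::
    "('t::topological_space, 'x::real_normed_vector) cabv \<Rightarrow> 't measure" where
  "cabv_variation \<mu> = measure_of UNIV (sets borel)
     (\<lambda>E. SUP P\<in>{P. finite P \<and> P \<subseteq> sets borel \<and> disjoint P \<and> \<Union>P \<subseteq> E}.
       \<Sum>B\<in>P. ennreal (norm (cabv_apply \<mu> B)))"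

lemma space_cabv_variation [simp]: "space (cabv_variation \<mu>) = UNIV"
  by (simp add: cabv_variation_def space_measure_of_conv)

lemma sets_cabv_variation [simp]: "sets (cabv_variation \<mu>) = sets borel"
  using sets.sigma_sets_eq[of borel] by (simp add: cabv_variation_def sets_measure_of)

text \<open>
  Superadditivity comes from joining finite families, subadditivity from cutting each member
  of a family along a countable partition and using \<open>\<sigma>\<close>-additivity of the vector measure.
\<close>

lemma emeasure_cabv_variation:
  assumes "E \<in> sets borel"
  shows "emeasure (cabv_variation \<mu>) E =
    (SUP P\<in>{P. finite P \<and> P \<subseteq> sets borel \<and> disjoint P \<and> \<Union>P \<subseteq> E}.
       \<Sum>B\<in>P. ennreal (norm (cabv_apply \<mu> B)))"
    (is "_ = ?V E")
    and sum_norm_le_emeasure_cabv_variation: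
      "\<lbrakk>finite I; disjoint_family_on A I; \<And>i. i \<in> I \<Longrightarrow> A i \<in> sets borel \<and> A i \<subseteq> E\<rbrakk> \<Longrightarrow>
        (\<Sum>i\<in>I. ennreal (norm (cabv_apply \<mu> (A i)))) \<le> emeasure (cabv_variation \<mu>) E"
proof -
  let ?n = "\<lambda>B. ennreal (norm (cabv_apply \<mu> B))"
  let ?F = "\<lambda>E. {P. finite P \<and> P \<subseteq> sets borel \<and> disjoint P \<and> \<Union>P \<subseteq> E}"
  have family: "(\<Sum>i\<in>I. ?n (A i)) \<le> ?V E"
    if A: "finite I" "disjoint_family_on A I" "\<And>i. i \<in> I \<Longrightarrow> A i \<in> sets borel \<and> A i \<subseteq> E"
    for I :: "'i set" and A E
  proof -
    let ?P = "A ` {i\<in>I. A i \<noteq> {}}"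
    note P = partition_of_disjoint_family[OF A(1,2) conjunct1[OF A(3)]]
    have "disjoint ?P"
      using P(3,4) unfolding partition_on_def by (meson disjoint_def subset_iff)
    then have "?P \<in> ?F E" using A by auto
    have "(\<Sum>i\<in>I. ?n (A i)) = (\<Sum>i\<in>{i\<in>I. A i \<noteq> {}}. ?n (A i))"
      using A(1) by (intro sum.mono_neutral_right) (auto simp: cabv_apply_empty)
    also have "\<dots> = (\<Sum>B\<in>?P. ?n B)" by (simp add: sum.reindex[OF P(5)])
    also have "\<dots> \<le> ?V E" by (rule SUP_upper[OF \<open>?P \<in> ?F E\<close>])
    finally show ?thesis .
  qed
  have two: "?V A + ?V B \<le> ?V (A \<union> B)" if "A \<inter> B = {}" for A B
  proof -
    have ne: "?F E \<noteq> {}" for E by (auto intro!: exI[of _ "{}"] simp: disjoint_def)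
    have "sum ?n P + sum ?n Q \<le> ?V (A \<union> B)" if P: "P \<in> ?F A" and Q: "Q \<in> ?F B" for P Q
    proof -
      \<comment> \<open>The disjoint sum as index set: the empty set may belong to both families.\<close>
      let ?c = "\<lambda>i. case i of Inl C \<Rightarrow> C | Inr C \<Rightarrow> C"
      have "(\<Sum>i\<in>P <+> Q. ?n (?c i)) \<le> ?V (A \<union> B)"
      proof (rule family)
        show "finite (P <+> Q)" using P Q by simp
        show "disjoint_family_on ?c (P <+> Q)"
          unfolding disjoint_family_on_def
        proof (intro ballI impI)
          fix i j assume ij: "i \<in> P <+> Q" "j \<in> P <+> Q" "i \<noteq> j"
          have "C \<inter> D = {}" if "C \<in> P" "D \<in> P" "C \<noteq> D" for C D
            using P that by (auto dest: disjointD)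
          moreover have "C \<inter> D = {}" if "C \<in> Q" "D \<in> Q" "C \<noteq> D" for C D
            using Q that by (auto dest: disjointD)
          moreover have "C \<inter> D = {}" "D \<inter> C = {}" if "C \<in> P" "D \<in> Q" for C D
            using P Q that \<open>A \<inter> B = {}\<close> by blast+
          ultimately show "?c i \<inter> ?c j = {}"
            using ij by (elim PlusE) simp_all
        qed
        show "?c i \<in> sets borel \<and> ?c i \<subseteq> A \<union> B" if "i \<in> P <+> Q" for i
        proof -
          have "C \<in> sets borel" if "C \<in> P \<or> C \<in> Q" for C using P Q that by auto
          moreover have "C \<subseteq> A \<union> B" if "C \<in> P \<or> C \<in> Q" for C using P Q that by fast
          ultimately show ?thesis using that by (elim PlusE) simp_all
        qed
      qed
      then show ?thesis using P Q by (simp add: sum.Plus del: sum_ennreal)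
    qed
    note joined = this
    have "sum ?n P + ?V B \<le> ?V (A \<union> B)" if "P \<in> ?F A" for P
    proof -
      have "sum ?n P + ?V B = (SUP Q\<in>?F B. sum ?n P + sum ?n Q)"
        by (rule ennreal_SUP_add_right[OF ne])
      also have "\<dots> \<le> ?V (A \<union> B)" by (rule SUP_least) (rule joined[OF that])
      finally show ?thesis .
    qed
    then have "(SUP P\<in>?F A. sum ?n P + ?V B) \<le> ?V (A \<union> B)"
      by (rule SUP_least)
    moreover have "(SUP P\<in>?F A. sum ?n P + ?V B) = ?V A + ?V B"
      by (rule ennreal_SUP_add_left[OF ne])
    ultimately show ?thesis by (simp only:)
  qed
  have mono: "?V A \<le> ?V B" if "A \<subseteq> B" for A B
    by (rule SUP_subset_mono[OF _ order_refl]) (simp add: Collect_mono_iff order_trans[OF _ that])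
  have fin: "(\<Sum>i<k. ?V (A i)) \<le> ?V (\<Union>i<k. A i)" if "disjoint_family A" for k and A :: "nat \<Rightarrow> _"
  proof (induction k)
    case (Suc k)
    have "A i \<inter> A k = {}" if "i < k" for i
      using \<open>disjoint_family A\<close> that by (simp add: disjoint_family_on_def)
    then have "(\<Union>i<k. A i) \<inter> A k = {}" by auto
    then have "?V (\<Union>i<k. A i) + ?V (A k) \<le> ?V ((\<Union>i<k. A i) \<union> A k)" by (rule two)
    then have "?V (\<Union>i<k. A i) + ?V (A k) \<le> ?V (\<Union>i<Suc k. A i)"
      by (simp only: lessThan_Suc UN_insert Un_commute)
    then show ?case
      unfolding sum.lessThan_Suc by (rule order_trans[OF add_right_mono[OF Suc.IH]])
  qed simp
  have "countably_additive (sets borel) ?V"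
    unfolding countably_additive_def
  proof (intro allI impI antisym)
    fix A :: "nat \<Rightarrow> 'a set"
    assume A: "range A \<subseteq> sets borel" "disjoint_family A"
    show "(\<Sum>i. ?V (A i)) \<le> ?V (\<Union>i. A i)"
    proof (rule suminf_le_const[OF summableI])
      fix k
      have "?V (\<Union>i<k. A i) \<le> ?V (\<Union>i. A i)" by (rule mono) blast
      with fin[OF A(2)] show "(\<Sum>i<k. ?V (A i)) \<le> ?V (\<Union>i. A i)" by (rule order_trans)
    qed
    show "?V (\<Union>i. A i) \<le> (\<Sum>i. ?V (A i))"
    proof (rule SUP_least)
      fix P assume P: "P \<in> ?F (\<Union>i. A i)"
      have "?n B \<le> (\<Sum>i. ?n (B \<inter> A i))" if "B \<in> P" for B
      proof (rule LIMSEQ_le_const2)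
        have "(\<lambda>i. cabv_apply \<mu> (B \<inter> A i)) sums cabv_apply \<mu> (\<Union>i. B \<inter> A i)"
          using P A that by (intro cabv_apply_sums) (auto simp: disjoint_family_on_def)
        moreover have "(\<Union>i. B \<inter> A i) = B" using P that by auto
        ultimately show "(\<lambda>k. ennreal (norm (\<Sum>i<k. cabv_apply \<mu> (B \<inter> A i)))) \<longlonglongrightarrow> ?n B"
          by (intro tendsto_ennrealI tendsto_norm) (simp add: sums_def)
        have "ennreal (norm (\<Sum>i<k. cabv_apply \<mu> (B \<inter> A i))) \<le> (\<Sum>i. ?n (B \<inter> A i))" for k
        proof -
          have "ennreal (norm (\<Sum>i<k. cabv_apply \<mu> (B \<inter> A i)))
              \<le> ennreal (\<Sum>i<k. norm (cabv_apply \<mu> (B \<inter> A i)))"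
            by (intro ennreal_leI norm_sum)
          also have "\<dots> = (\<Sum>i<k. ?n (B \<inter> A i))" by (simp add: sum_ennreal)
          also have "\<dots> \<le> (\<Sum>i. ?n (B \<inter> A i))" by (rule sum_le_suminf) auto
          finally show ?thesis .
        qed
        then show "\<exists>N. \<forall>k\<ge>N. ennreal (norm (\<Sum>i<k. cabv_apply \<mu> (B \<inter> A i))) \<le> (\<Sum>i. ?n (B \<inter> A i))"
          by blast
      qed
      then have "sum ?n P \<le> (\<Sum>B\<in>P. \<Sum>i. ?n (B \<inter> A i))" by (rule sum_mono)
      also have "\<dots> = (\<Sum>i. \<Sum>B\<in>P. ?n (B \<inter> A i))" by (rule suminf_sum[symmetric]) simp
      also have "\<dots> \<le> (\<Sum>i. ?V (A i))"
      proof (intro suminf_le allI summableI family)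
        fix i
        show "finite P" using P by simp
        show "disjoint_family_on (\<lambda>B. B \<inter> A i) P"
          using P by (auto simp: disjoint_family_on_def disjoint_def)
        show "B \<inter> A i \<in> sets borel \<and> B \<inter> A i \<subseteq> A i" if "B \<in> P" for B
          using P A that by auto
      qed
      finally show "sum ?n P \<le> (\<Sum>i. ?V (A i))" .
    qed
  qed
  moreover have "positive (sets borel) ?V"
  proof -
    have "sum ?n P = 0" if "P \<in> ?F {}" for P
      using that by (intro sum.neutral ballI) (auto simp: cabv_apply_empty)
    then have "?V {} \<le> 0" by (intro SUP_least) simp
    then show ?thesis by (simp add: positive_def)
  qed
  ultimately show *: "emeasure (cabv_variation \<mu>) E = ?V E"
    using assms by (intro emeasure_measure_of[OF cabv_variation_def]) auto
  show "(\<Sum>i\<in>I. ?n (A i)) \<le> emeasure (cabv_variation \<mu>) E"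
    if A: "finite I" "disjoint_family_on A I" "\<And>i. i \<in> I \<Longrightarrow> A i \<in> sets borel \<and> A i \<subseteq> E"
    using family[OF A] unfolding * .
qed

lemma emeasure_cabv_variation_UNIV_le: "emeasure (cabv_variation \<mu>) UNIV \<le> ennreal (norm \<mu>)"
proof -
  have "(\<Sum>B\<in>P. ennreal (norm (cabv_apply \<mu> B))) \<le> ennreal (norm \<mu>)"
    if "finite P" "P \<subseteq> sets borel" "disjoint P" for P
  proof -
    have "disjoint_family_on (\<lambda>B. B) P"
      using that(3) by (auto simp: disjoint_family_on_def disjoint_def)
    then have "(\<Sum>B\<in>P. norm (cabv_apply \<mu> B)) \<le> norm \<mu>"
      using that by (intro sum_norm_cabv_le[of P "\<lambda>B. B"]) auto
    then show ?thesis by (simp add: sum_ennreal ennreal_leI)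
  qed
  then show ?thesis by (subst emeasure_cabv_variation) (auto intro!: SUP_least)
qed

lemma finite_measure_cabv_variation: "finite_measure (cabv_variation \<mu>)"
proof (rule finite_measureI)
  have "emeasure (cabv_variation \<mu>) UNIV < top"
    by (rule le_less_trans[OF emeasure_cabv_variation_UNIV_le ennreal_less_top])
  then show "emeasure (cabv_variation \<mu>) (space (cabv_variation \<mu>)) \<noteq> \<infinity>" by simp
qed

lemma measure_cabv_variation_UNIV_le: "measure (cabv_variation \<mu>) UNIV \<le> norm \<mu>"
  unfolding measure_def
  using emeasure_cabv_variation_UNIV_le[of \<mu>] by (intro enn2real_leI) auto

lemma sum_norm_le_cabv_variation:
  assumes "finite I" "disjoint_family_on A I" "\<And>i. i \<in> I \<Longrightarrow> A i \<in> sets borel \<and> A i \<subseteq> E"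
    and "E \<in> sets borel"
  shows "(\<Sum>i\<in>I. norm (cabv_apply \<mu> (A i))) \<le> measure (cabv_variation \<mu>) E"
proof -
  interpret finite_measure "cabv_variation \<mu>" by (rule finite_measure_cabv_variation)
  have "ennreal (\<Sum>i\<in>I. norm (cabv_apply \<mu> (A i))) \<le> emeasure (cabv_variation \<mu>) E"
    using sum_norm_le_emeasure_cabv_variation[OF assms(4,1-3)] by (simp add: sum_ennreal)
  then show ?thesis by (simp add: emeasure_eq_measure)
qed

text \<open>
  The sets that are squeezed between a closed and an open set with small difference form
  a \<open>\<sigma>\<close>-algebra. It contains the closed sets, a closed set of a metric space being the
  intersection of its neighbourhoods \<open>infdist x C < 1 / n\<close>.
\<close>

lemma borel_closed_open_approx:
  fixes M :: "'a::metric_space measure"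
  assumes "finite_measure M" and sets_M: "sets M = sets borel"
    and B: "B \<in> sets borel" and "0 < e"
  shows "\<exists>F U. closed F \<and> open U \<and> F \<subseteq> B \<and> B \<subseteq> U \<and> measure M (U - F) < e"
proof -
  interpret finite_measure M by fact
  have "B \<in> sigma_sets UNIV (Collect closed)" 
    using B unfolding borel_eq_closed by (subst (asm) sets_measure_of) auto
  then show ?thesis using \<open>0 < e\<close>
  proof (induction arbitrary: e rule: sigma_sets.induct)
    case (Basic C)
    then have C: "closed C" by simp
    show ?case
    proof (cases "C = {}")
      case True
      then show ?thesis using Basic by (intro exI[of _ "{}"]) auto
    next
      case False
      define U where "U k = {x. infdist x C < 1 / Suc k}" for k
      have open_U: "open (U k)" for k
        unfolding U_def by (intro open_Collect_less continuous_intros)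
      have C_U: "C \<subseteq> U k" for k by (auto simp: U_def)
      have "(\<Inter>k. U k - C) = {}"
      proof -
        have "x \<in> C" if "\<And>k. x \<in> U k" for x
        proof -
          have "infdist x C \<le> e" if "0 < e" for e
          proof -
            obtain k where "1 / Suc k < e" using nat_approx_posE[OF \<open>0 < e\<close>] .
            moreover have "infdist x C < 1 / Suc k" using \<open>x \<in> U k\<close> by (simp add: U_def)
            ultimately show ?thesis by simp
          qed
          then have "infdist x C \<le> 0" by (rule field_le_epsilon) simp
          then show ?thesis
            using C False infdist_nonneg[of x C] by (simp add: in_closed_iff_infdist_zero)
        qed
        then show ?thesis by auto
      qed
      moreover have "(\<lambda>k. measure M (U k - C)) \<longlonglongrightarrow> measure M (\<Inter>k. U k - C)"
      proof (rule finite_Lim_measure_decseq)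
        show "range (\<lambda>k. U k - C) \<subseteq> sets M"
          using open_U C by (auto simp: sets_M)
        have "1 / real (Suc l) \<le> 1 / real (Suc k)" if "k \<le> l" for k l
          using that by (intro divide_left_mono) auto
        then show "decseq (\<lambda>k. U k - C)"
          unfolding decseq_def U_def by (fastforce intro: less_le_trans)
      qed
      ultimately have "(\<lambda>k. measure M (U k - C)) \<longlonglongrightarrow> 0" by (simp only: measure_empty)
      then have "\<forall>\<^sub>F k in sequentially. measure M (U k - C) < e"
        by (rule order_tendstoD(2)) (rule Basic.prems)
      then obtain k where "measure M (U k - C) < e"
        by (auto simp: eventually_sequentially)
      then show ?thesis using C open_U C_U by blast
    qed
  next
    case Empty
    then show ?case by (intro exI[of _ "{}"]) auto
  next
    case (Compl B)
    obtain F U where FU: "closed F" "open U" "F \<subseteq> B" "B \<subseteq> U" "measure M (U - F) < e"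
      using Compl.IH[OF Compl.prems] by blast
    have "- F - - U = U - F" by blast
    then show ?case
      using FU by (intro exI[of _ "- U"] exI[of _ "- F"]) auto
  next
    case (Union B)
    define d where "d i = e / 4 * (1 / 2) ^ i" for i :: nat
    have "0 < d i" for i using Union.prems by (simp add: d_def)
    then have "\<forall>i. \<exists>F U. closed F \<and> open U \<and> F \<subseteq> B i \<and> B i \<subseteq> U \<and> measure M (U - F) < d i"
      using Union.IH by blast
    then obtain F U where FU: "\<And>i. closed (F i)" "\<And>i. open (U i)" "\<And>i. F i \<subseteq> B i"
      "\<And>i. B i \<subseteq> U i" "\<And>i. measure M (U i - F i) < d i" by metis
    have "d sums (e / 4 * (1 / (1 - 1 / 2)))"
      unfolding d_def by (intro sums_mult geometric_sums) simp
    then have d: "d sums (e / 2)" by simp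
    have F_sets: "F i \<in> sets M" and U_sets: "U i \<in> sets M" for i
      using FU by (auto simp: sets_M)
    \<comment> \<open>Only finitely many \<open>F i\<close> may be united to a closed set. The error splits into the union of
      all errors and the part of the full union that finitely many \<open>F i\<close> miss.\<close>
    let ?D = "\<Union>i. U i - F i"
    have "measure M ?D \<le> e / 2"
    proof -
      have s: "summable (\<lambda>i. measure M (U i - F i))"
        using FU(5) by (intro summable_comparison_test[OF _ sums_summable[OF d]])
          (auto intro!: exI[of _ 0] less_imp_le)
      have "measure M ?D \<le> (\<Sum>i. measure M (U i - F i))"
        using F_sets U_sets by (intro finite_measure_subadditive_countably s) auto
      also have "\<dots> \<le> suminf d"
        using FU(5) by (intro suminf_le s sums_summable[OF d]) (simp add: less_imp_le)
      also have "\<dots> = e / 2" using d by (rule sums_unique[symmetric])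
      finally show ?thesis .
    qed
    let ?K = "\<lambda>k. (\<Union>i. F i) - (\<Union>i<k. F i)"
    have "(\<lambda>k. measure M (?K k)) \<longlonglongrightarrow> measure M (\<Inter>k. ?K k)"
      using F_sets by (intro finite_Lim_measure_decseq) (auto simp: decseq_def)
    moreover have "(\<Inter>k. ?K k) = {}" by blast
    ultimately have "(\<lambda>k. measure M (?K k)) \<longlonglongrightarrow> 0" by (simp only: measure_empty)
    then have "\<forall>\<^sub>F k in sequentially. measure M (?K k) < e / 2"
      by (rule order_tendstoD(2)) (simp add: Union.prems)
    then obtain k where k: "measure M (?K k) < e / 2"
      by (auto simp: eventually_sequentially)
    have "measure M ((\<Union>i. U i) - (\<Union>i<k. F i)) \<le> measure M (?D \<union> ?K k)"
      using F_sets U_sets by (intro finite_measure_mono) auto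
    also have "\<dots> \<le> measure M ?D + measure M (?K k)"
      using F_sets U_sets by (intro measure_Un_le) auto
    also have "\<dots> < e" using k \<open>measure M ?D \<le> e / 2\<close> by simp
    finally have "measure M ((\<Union>i. U i) - (\<Union>i<k. F i)) < e" .
    moreover have "closed (\<Union>i<k. F i)" using FU(1) by (intro closed_UN) auto
    moreover have "open (\<Union>i. U i)" using FU(2) by (intro open_UN) auto
    moreover have "(\<Union>i<k. F i) \<subseteq> (\<Union>i. B i)" using FU(3) by (intro UN_mono) auto
    moreover have "(\<Union>i. B i) \<subseteq> (\<Union>i. U i)" using FU(4) by (intro UN_mono) auto
    ultimately show ?case by (intro exI[of _ "\<Union>i<k. F i"] exI[of _ "\<Union>i. U i"] conjI)
  qed
qed

section \<open>Integration against a vector measure\<close>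

lemma simple_function_borel_range:
  "simple_function borel g \<Longrightarrow> finite (range g)"
  using simple_functionD(1)[of borel g] by simp

lemma simple_function_borel_vimage:
  "simple_function borel g \<Longrightarrow> g -` X \<in> sets borel"
  using simple_functionD(2)[of borel g X] by simp

lemma disjoint_family_on_vimage: "disjoint_family_on (\<lambda>z. g -` {z}) S"
  by (auto simp: disjoint_family_on_def)

text \<open>
  The integral of a simple function may be computed on any finer finite partition. This is
  how integrals of two simple functions are compared: both are functions of the pair.
\<close>

lemma simple_cabv_integral_compose:
  fixes g :: "'t::topological_space \<Rightarrow> 'z"
  assumes g: "simple_function borel g"
  shows "simple_cabv_integral (\<lambda>t. \<phi> (g t)) \<mu> =
    (\<Sum>z\<in>range g. scalar_prod (\<phi> z) (cabv_apply \<mu> (g -` {z})))"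
proof -
  note fin = simple_function_borel_range[OF g]
  let ?G = "\<lambda>x. {z. z \<in> range g \<and> \<phi> z = x}"
  have "scalar_prod x (cabv_apply \<mu> ((\<lambda>t. \<phi> (g t)) -` {x}))
      = (\<Sum>z\<in>?G x. scalar_prod (\<phi> z) (cabv_apply \<mu> (g -` {z})))" for x
  proof -
    have "(\<lambda>t. \<phi> (g t)) -` {x} = (\<Union>z\<in>?G x. g -` {z})" by auto
    also have "cabv_apply \<mu> \<dots> = (\<Sum>z\<in>?G x. cabv_apply \<mu> (g -` {z}))"
      using fin simple_function_borel_vimage[OF g] disjoint_family_on_vimage
      by (intro cabv_apply_UN) auto
    finally show ?thesis by (simp add: scalar_prod.sum_right)
  qed
  then have "simple_cabv_integral (\<lambda>t. \<phi> (g t)) \<mu>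
      = (\<Sum>x\<in>range (\<lambda>t. \<phi> (g t)). \<Sum>z\<in>?G x. scalar_prod (\<phi> z) (cabv_apply \<mu> (g -` {z})))"
    by (simp add: simple_cabv_integral_def)
  also have "\<dots> = (\<Sum>z\<in>range g. scalar_prod (\<phi> z) (cabv_apply \<mu> (g -` {z})))"
  proof (rule sum.group[OF fin])
    show "finite (range (\<lambda>t. \<phi> (g t)))"
      using finite_imageI[OF fin, of \<phi>] by (simp add: image_image)
  qed auto
  finally show ?thesis .
qed

lemma simple_cabv_integral_diff:
  assumes "simple_function borel f" "simple_function borel g"
  shows "simple_cabv_integral (\<lambda>t. f t - g t) \<mu> =
    simple_cabv_integral f \<mu> - simple_cabv_integral g \<mu>"
proof -
  have p: "simple_function borel (\<lambda>t. (f t, g t))" using assms by (rule simple_function_Pair)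
  show ?thesis
    using simple_cabv_integral_compose[OF p, of "\<lambda>z. fst z - snd z" \<mu>]
      simple_cabv_integral_compose[OF p, of fst \<mu>] simple_cabv_integral_compose[OF p, of snd \<mu>]
    by (simp add: scalar_prod.diff_left sum_subtractf)
qed

lemma norm_simple_cabv_integral_le:
  assumes f: "simple_function borel f" and C: "\<And>t. norm (f t) \<le> C"
    and E: "E \<in> sets borel" "\<And>t. t \<notin> E \<Longrightarrow> f t = 0"
  shows "norm (simple_cabv_integral f \<mu>) \<le> C * measure (cabv_variation \<mu>) E"
proof -
  note fin = simple_function_borel_range[OF f]
  have "0 \<le> C" using C[of undefined] norm_ge_zero order_trans by blast
  have "simple_cabv_integral f \<mu> = (\<Sum>x\<in>range f - {0}. scalar_prod x (cabv_apply \<mu> (f -` {x})))"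
    unfolding simple_cabv_integral_def
    using fin by (intro sum.mono_neutral_right) (auto simp: scalar_prod.zero_left)
  also have "norm \<dots> \<le> (\<Sum>x\<in>range f - {0}. C * norm (cabv_apply \<mu> (f -` {x})))"
  proof (rule order_trans[OF norm_sum sum_mono])
    fix x assume "x \<in> range f - {0}"
    then have "norm x \<le> C" using C by auto
    then show "norm (scalar_prod x (cabv_apply \<mu> (f -` {x}))) \<le> C * norm (cabv_apply \<mu> (f -` {x}))"
      by (intro order_trans[OF norm_scalar_prod_le] mult_right_mono) auto
  qed
  also have "\<dots> = C * (\<Sum>x\<in>range f - {0}. norm (cabv_apply \<mu> (f -` {x})))"
    by (simp add: sum_distrib_left)
  also have "\<dots> \<le> C * measure (cabv_variation \<mu>) E"
  proof (intro mult_left_mono sum_norm_le_cabv_variation)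
    show "f -` {x} \<in> sets borel \<and> f -` {x} \<subseteq> E" if "x \<in> range f - {0}" for x
      using that E(2) simple_function_borel_vimage[OF f] by auto
  qed (use fin E(1) disjoint_family_on_vimage \<open>0 \<le> C\<close> in auto)
  finally show ?thesis .
qed

lemma norm_simple_cabv_integral_diff_le:
  assumes "simple_function borel f" "simple_function borel g" "\<And>t. dist (f t) (g t) \<le> e"
  shows "norm (simple_cabv_integral f \<mu> - simple_cabv_integral g \<mu>) \<le> e * norm \<mu>"
proof -
  have "0 \<le> e" using assms(3)[of undefined] zero_le_dist order_trans by blast
  have "norm (simple_cabv_integral (\<lambda>t. f t - g t) \<mu>) \<le> e * measure (cabv_variation \<mu>) UNIV"
    using assms by (intro norm_simple_cabv_integral_le) (auto simp: dist_norm)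
  also have "\<dots> \<le> e * norm \<mu>"
    using \<open>0 \<le> e\<close> measure_cabv_variation_UNIV_le by (intro mult_left_mono)
  finally show ?thesis by (simp add: simple_cabv_integral_diff[OF assms(1,2)])
qed

text \<open>
  The integral is defined on the uniform limits of simple functions; on a compact space these
  include the continuous functions (lemma \<open>integrable_fun_continuous\<close>).
\<close>

definition approximates ::
    "(nat \<Rightarrow> 't::topological_space \<Rightarrow> 'x::metric_space) \<Rightarrow> ('t \<Rightarrow> 'x) \<Rightarrow> bool" where
  "approximates s f \<longleftrightarrow>
     (\<forall>m. simple_function borel (s m)) \<and> uniform_limit UNIV s f sequentially"

definition integrable_fun :: "('t::topological_space \<Rightarrow> 'x::metric_space) \<Rightarrow> bool" where
  "integrable_fun f \<longleftrightarrow> (\<exists>s. approximates s f)"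

lemma approximatesD:
  "approximates s f \<Longrightarrow> simple_function borel (s m)"
  "approximates s f \<Longrightarrow> 0 < e \<Longrightarrow> \<forall>\<^sub>F m in sequentially. \<forall>t. dist (s m t) (f t) < e"
  by (auto simp: approximates_def dest: uniform_limitD)

text \<open>
  Any two approximating sequences are eventually uniformly close, so their integrals are:
  applied to one sequence this gives the Cauchy property, applied to two the independence
  of the choice.
\<close>

lemma simple_cabv_integrals_eventually_close:
  assumes s: "approximates s f" and s': "approximates s' f" and "0 < e"
  shows "\<exists>M. \<forall>m\<ge>M. \<forall>n\<ge>M.
    norm (simple_cabv_integral (s m) \<mu> - simple_cabv_integral (s' n) \<mu>) < e"
proof -
  \<comment> \<open>Two functions within \<open>d\<close> of \<open>f\<close> differ by at most \<open>2 * d\<close>; the summand 1 covers \<open>\<mu> = 0\<close>.\<close>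
  define d where "d = e / (2 * (norm \<mu> + 1))"
  have pos: "0 < norm \<mu> + 1" using norm_ge_zero[of \<mu>] by linarith
  have "0 < d" using \<open>0 < e\<close> pos by (simp add: d_def)
  have "\<forall>\<^sub>F m in sequentially. (\<forall>t. dist (s m t) (f t) < d) \<and> (\<forall>t. dist (s' m t) (f t) < d)"
    using approximatesD(2)[OF s \<open>0 < d\<close>] approximatesD(2)[OF s' \<open>0 < d\<close>] by eventually_elim blast
  then obtain M where M: "\<And>m t. M \<le> m \<Longrightarrow> dist (s m t) (f t) < d"
      "\<And>m t. M \<le> m \<Longrightarrow> dist (s' m t) (f t) < d"
    by (auto simp: eventually_sequentially)
  have "norm (simple_cabv_integral (s m) \<mu> - simple_cabv_integral (s' n) \<mu>) < e"
    if "M \<le> m" "M \<le> n" for m n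
  proof -
    have "dist (s m t) (s' n t) \<le> 2 * d" for t
      using dist_triangle2[of "s m t" "s' n t" "f t"] M(1)[OF that(1), of t] M(2)[OF that(2), of t]
      by linarith
    then have "norm (simple_cabv_integral (s m) \<mu> - simple_cabv_integral (s' n) \<mu>) \<le> 2 * d * norm \<mu>"
      using approximatesD(1)[OF s] approximatesD(1)[OF s']
      by (intro norm_simple_cabv_integral_diff_le)
    also have "\<dots> < 2 * d * (norm \<mu> + 1)" using \<open>0 < d\<close> by simp
    also have "\<dots> = e"
    proof -
      have "2 * (e / (2 * c)) * c = e" if "0 < c" for c using that by simp
      from this[OF pos] show ?thesis by (simp only: d_def)
    qed
    finally show ?thesis .
  qed
  then show ?thesis by blast
qed

lemma cabv_integral_tendsto:
  assumes s: "approximates s f"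
  shows "(\<lambda>m. simple_cabv_integral (s m) \<mu>) \<longlonglongrightarrow> cabv_integral f \<mu>"
proof -
  have "Cauchy (\<lambda>m. simple_cabv_integral (s m) \<mu>)"
    by (rule CauchyI) (rule simple_cabv_integrals_eventually_close[OF s s])
  then obtain I where I: "(\<lambda>m. simple_cabv_integral (s m) \<mu>) \<longlonglongrightarrow> I"
    using Cauchy_convergent convergentD by blast
  have unique: "J = I" if s': "approximates s' f" and J: "(\<lambda>m. simple_cabv_integral (s' m) \<mu>) \<longlonglongrightarrow> J"
    for s' J
  proof -
    have "(\<lambda>m. simple_cabv_integral (s' m) \<mu> - simple_cabv_integral (s m) \<mu>) \<longlonglongrightarrow> 0"
      using simple_cabv_integrals_eventually_close[OF s' s, where \<mu> = \<mu>]
      by (intro LIMSEQ_I) (simp, blast)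
    moreover have "(\<lambda>m. simple_cabv_integral (s' m) \<mu> - simple_cabv_integral (s m) \<mu>) \<longlonglongrightarrow> J - I"
      by (intro tendsto_diff I J)
    ultimately have "J - I = 0" using LIMSEQ_unique by blast
    then show ?thesis by simp
  qed
  have "cabv_integral f \<mu> = I"
    unfolding cabv_integral_def
  proof (rule the_equality)
    show "\<exists>s. (\<forall>m. simple_function borel (s m)) \<and> uniform_limit UNIV s f sequentially \<and>
        (\<lambda>m. simple_cabv_integral (s m) \<mu>) \<longlonglongrightarrow> I"
      using s I by (auto simp: approximates_def)
    show "J = I" if "\<exists>s. (\<forall>m. simple_function borel (s m)) \<and> uniform_limit UNIV s f sequentially \<and>
        (\<lambda>m. simple_cabv_integral (s m) \<mu>) \<longlonglongrightarrow> J" for J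
      using that unique by (auto simp: approximates_def)
  qed
  with I show ?thesis by simp
qed

lemma integrable_funE:
  assumes "integrable_fun f"
  obtains s where "approximates s f"
  using assms unfolding integrable_fun_def by (rule exE)

lemma approximates_simple: "simple_function borel f \<Longrightarrow> approximates (\<lambda>_. f) f"
  by (simp add: approximates_def uniform_limit_iff)

lemma cabv_integral_simple:
  assumes "simple_function borel f"
  shows "cabv_integral f \<mu> = simple_cabv_integral f \<mu>"
  using cabv_integral_tendsto[OF approximates_simple[OF assms], of \<mu>]
  by (simp add: LIMSEQ_const_iff)

lemma approximates_diff:
  fixes f g :: "'t::topological_space \<Rightarrow> 'x::real_normed_vector"
  assumes "approximates s f" "approximates s' g"
  shows "approximates (\<lambda>m t. s m t - s' m t) (\<lambda>t. f t - g t)"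
  using assms unfolding approximates_def
  by (auto intro: uniform_limit_minus simple_function_compose2[where h = "(-)"])

lemma cabv_integral_diff:
  assumes "integrable_fun f" "integrable_fun g"
  shows "cabv_integral (\<lambda>t. f t - g t) \<mu> = cabv_integral f \<mu> - cabv_integral g \<mu>"
proof -
  obtain s where s: "approximates s f" using integrable_funE[OF assms(1)] .
  obtain s' where s': "approximates s' g" using integrable_funE[OF assms(2)] .
  have "(\<lambda>m. simple_cabv_integral (s m) \<mu> - simple_cabv_integral (s' m) \<mu>)
      \<longlonglongrightarrow> cabv_integral (\<lambda>t. f t - g t) \<mu>"
    using cabv_integral_tendsto[OF approximates_diff[OF s s'], of \<mu>]
    by (simp add: simple_cabv_integral_diff approximatesD(1)[OF s] approximatesD(1)[OF s'])
  moreover have "(\<lambda>m. simple_cabv_integral (s m) \<mu> - simple_cabv_integral (s' m) \<mu>)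
      \<longlonglongrightarrow> cabv_integral f \<mu> - cabv_integral g \<mu>"
    by (intro tendsto_diff cabv_integral_tendsto s s')
  ultimately show ?thesis by (rule LIMSEQ_unique)
qed

lemma integrable_fun_diff:
  fixes f g :: "'t::topological_space \<Rightarrow> 'x::real_normed_vector"
  shows "integrable_fun f \<Longrightarrow> integrable_fun g \<Longrightarrow> integrable_fun (\<lambda>t. f t - g t)"
  unfolding integrable_fun_def using approximates_diff by blast

lemma cabv_integral_scaleR:
  assumes f: "integrable_fun f"
  shows "cabv_integral (\<lambda>t. c *\<^sub>R f t) \<mu> = c *\<^sub>R cabv_integral f \<mu>"
proof -
  obtain s where s: "approximates s f" using integrable_funE[OF f] .
  note simple = approximatesD(1)[OF s]
  have "uniform_limit UNIV (\<lambda>m t. c *\<^sub>R s m t) (\<lambda>t. c *\<^sub>R f t) sequentially"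
    using s unfolding approximates_def
    by (intro bounded_linear.uniform_limit[OF bounded_linear_scaleR_right]) auto
  then have "approximates (\<lambda>m t. c *\<^sub>R s m t) (\<lambda>t. c *\<^sub>R f t)"
    unfolding approximates_def by (intro conjI allI simple_function_compose1[OF simple])
  then have "(\<lambda>m. simple_cabv_integral (\<lambda>t. c *\<^sub>R s m t) \<mu>)
      \<longlonglongrightarrow> cabv_integral (\<lambda>t. c *\<^sub>R f t) \<mu>"
    by (rule cabv_integral_tendsto)
  moreover have "simple_cabv_integral (\<lambda>t. c *\<^sub>R s m t) \<mu> = c *\<^sub>R simple_cabv_integral (s m) \<mu>" for m
    unfolding simple_cabv_integral_compose[OF simple, of "scaleR c"]
    by (simp add: simple_cabv_integral_def scalar_prod.scaleR_left scaleR_sum_right)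
  ultimately have "(\<lambda>m. c *\<^sub>R simple_cabv_integral (s m) \<mu>)
      \<longlonglongrightarrow> cabv_integral (\<lambda>t. c *\<^sub>R f t) \<mu>"
    by (simp only:)
  moreover have "(\<lambda>m. c *\<^sub>R simple_cabv_integral (s m) \<mu>) \<longlonglongrightarrow> c *\<^sub>R cabv_integral f \<mu>"
    by (intro tendsto_scaleR tendsto_const cabv_integral_tendsto s)
  ultimately show ?thesis by (rule LIMSEQ_unique)
qed

text \<open>
  Cutting the approximating functions off outside \<open>E\<close> does not spoil the approximation, so the
  bound for simple functions passes to the limit.
\<close>

lemma norm_cabv_integral_le:
  assumes f: "integrable_fun f" and C: "\<And>t. norm (f t) \<le> C"
    and E: "E \<in> sets borel" "\<And>t. t \<notin> E \<Longrightarrow> f t = 0"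
  shows "norm (cabv_integral f \<mu>) \<le> C * measure (cabv_variation \<mu>) E"
proof -
  obtain s where s: "approximates s f" using integrable_funE[OF f] .
  define s' where "s' m t = (if t \<in> E then s m t else 0)" for m t
  have s': "approximates s' f"
    unfolding approximates_def
  proof (intro conjI allI uniform_limitI)
    show "simple_function borel (s' m)" for m
      unfolding s'_def using approximatesD(1)[OF s] E(1)
      by (intro simple_function_If) auto
    show "\<forall>\<^sub>F m in sequentially. \<forall>t\<in>UNIV. dist (s' m t) (f t) < e" if "0 < e" for e
      using approximatesD(2)[OF s that]
      by eventually_elim (auto simp: s'_def E(2) that)
  qed
  let ?v = "measure (cabv_variation \<mu>) E"
  have "norm (cabv_integral f \<mu>) \<le> C * ?v + d" if "0 < d" for d
  proof -
    define e where "e = d / (?v + 1)"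
    have "0 < ?v + 1" using measure_nonneg[of "cabv_variation \<mu>" E] by linarith
    then have "0 < e" using \<open>0 < d\<close> by (simp add: e_def)
    have "\<forall>\<^sub>F m in sequentially. norm (simple_cabv_integral (s' m) \<mu>) \<le> (C + e) * ?v"
      using approximatesD(2)[OF s' \<open>0 < e\<close>]
    proof eventually_elim
      case (elim m)
      have "norm (s' m t) \<le> C + e" for t
        using elim[rule_format, of t] C[of t] norm_triangle_sub[of "s' m t" "f t"]
        by (simp add: dist_norm)
      then show ?case
        using approximatesD(1)[OF s'] E(1)
        by (intro norm_simple_cabv_integral_le) (auto simp: s'_def)
    qed
    then have "norm (cabv_integral f \<mu>) \<le> (C + e) * ?v"
      by (intro tendsto_upperbound[OF tendsto_norm[OF cabv_integral_tendsto[OF s']]]) auto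
    also have "(C + e) * ?v \<le> C * ?v + e * (?v + 1)"
      using \<open>0 < e\<close> by (simp add: algebra_simps)
    also have "\<dots> = C * ?v + d" using \<open>0 < ?v + 1\<close> by (simp add: e_def)
    finally show ?thesis .
  qed
  then show ?thesis by (rule field_le_epsilon)
qed

lemma norm_cabv_integral_le_norm:
  assumes "integrable_fun f" "\<And>t. norm (f t) \<le> C"
  shows "norm (cabv_integral f \<mu>) \<le> C * norm \<mu>"
proof -
  have "0 \<le> C" using assms(2)[of undefined] norm_ge_zero order_trans by blast
  have "norm (cabv_integral f \<mu>) \<le> C * measure (cabv_variation \<mu>) UNIV"
    using assms by (intro norm_cabv_integral_le) auto
  also have "\<dots> \<le> C * norm \<mu>"
    using \<open>0 \<le> C\<close> measure_cabv_variation_UNIV_le by (intro mult_left_mono)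
  finally show ?thesis .
qed

text \<open>
  This linearity is in the measure: it makes the weak* topology coarser than the norm topology
  and lets the integral pass through the series that defines \<open>H\<close>.
\<close>

lemma bounded_linear_cabv_integral:
  fixes f :: "'a::topological_space \<Rightarrow> 'b::real_or_complex ^ 'c"
  assumes f: "integrable_fun f" and C: "\<And>t. norm (f t) \<le> C"
  shows "bounded_linear (cabv_integral f)"
proof (rule bounded_linear_intro)
  obtain s where s: "approximates s f" using integrable_funE[OF f] .
  note lim = cabv_integral_tendsto[OF s]
  fix \<mu> \<nu> :: "('a, 'b ^ 'c) cabv" and c :: real
  have "simple_cabv_integral g (\<mu> + \<nu>) = simple_cabv_integral g \<mu> + simple_cabv_integral g \<nu>" for g
    by (simp add: simple_cabv_integral_def plus_cabv.rep_eq scalar_prod.add_right sum.distrib)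
  then show "cabv_integral f (\<mu> + \<nu>) = cabv_integral f \<mu> + cabv_integral f \<nu>"
    using tendsto_add[OF lim[of \<mu>] lim[of \<nu>]] lim[of "\<mu> + \<nu>"] by (simp add: LIMSEQ_unique)
  have "simple_cabv_integral g (c *\<^sub>R \<mu>) = c *\<^sub>R simple_cabv_integral g \<mu>" for g
    by (simp add: simple_cabv_integral_def scaleR_cabv.rep_eq scalar_prod.scaleR_right scaleR_sum_right)
  then show "cabv_integral f (c *\<^sub>R \<mu>) = c *\<^sub>R cabv_integral f \<mu>"
    using tendsto_scaleR[OF tendsto_const lim[of \<mu>], of c] lim[of "c *\<^sub>R \<mu>"]
    by (simp add: LIMSEQ_unique)
  show "norm (cabv_integral f \<mu>) \<le> norm \<mu> * C"
    using norm_cabv_integral_le_norm[OF f C] by (simp add: mult.commute)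
qed

text \<open>
  By compactness the space is covered by finitely many open sets on each of which \<open>f\<close> stays within
  \<open>e\<close> of its value at a chosen point. The values at these points make up the simple function.
\<close>

lemma integrable_fun_continuous:
  fixes f :: "'t::metric_space \<Rightarrow> 'x::metric_space"
  assumes T: "compact (UNIV :: 't set)" and f: "continuous_on UNIV f"
  shows "integrable_fun f"
proof -
  have step: "\<exists>s. simple_function borel s \<and> (\<forall>t. dist (s t) (f t) < e)" if "0 < e" for e :: real
  proof -
    let ?U = "\<lambda>x. f -` ball (f x) e"
    have U: "open (?U x)" for x using f by (intro open_vimage) auto
    obtain F where F: "finite F" "UNIV \<subseteq> (\<Union>x\<in>F. ?U x)"
    proof (rule compactE_image[OF T, of UNIV ?U])
      show "UNIV \<subseteq> (\<Union>x\<in>UNIV. ?U x)" using \<open>0 < e\<close> by auto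
    qed (use U in auto)
    have "\<exists>s. simple_function borel s \<and> (\<forall>t\<in>\<Union>x\<in>F. ?U x. dist (s t) (f t) < e)"
      using F(1)
    proof (induction F)
      case empty
      show ?case by (intro exI[of _ "\<lambda>_. undefined"]) simp
    next
      case (insert x F)
      then obtain s where s: "simple_function borel s" "\<forall>t\<in>\<Union>x\<in>F. ?U x. dist (s t) (f t) < e"
        by blast
      show ?case
      proof (intro exI conjI)
        have "{t \<in> space borel. t \<in> ?U x} = ?U x" by auto
        with borel_open[OF U[of x]] have "{t \<in> space borel. t \<in> ?U x} \<in> sets borel"
          by (simp only:)
        with s(1) show "simple_function borel (\<lambda>t. if t \<in> ?U x then f x else s t)"
          by (intro simple_function_If simple_function_const)
        show "\<forall>t\<in>\<Union>x\<in>insert x F. ?U x. dist (if t \<in> ?U x then f x else s t) (f t) < e"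
          using s(2) by auto
      qed
    qed
    then show ?thesis using F(2) by blast
  qed
  have "\<forall>m. \<exists>s. simple_function borel s \<and> (\<forall>t. dist (s t) (f t) < 1 / real (Suc m))"
    by (intro allI step) simp
  then obtain s where s: "\<And>m. simple_function borel (s m)"
      "\<And>m t. dist (s m t) (f t) < 1 / real (Suc m)"
    by metis
  have "uniform_limit UNIV s f sequentially"
  proof (rule uniform_limitI)
    fix e :: real assume "0 < e"
    then obtain M where M: "1 / real (Suc M) < e" using nat_approx_posE by blast
    have "dist (s m t) (f t) < e" if "M \<le> m" for m t
    proof -
      have "1 / real (Suc m) \<le> 1 / real (Suc M)" using that by (intro divide_left_mono) auto
      with s(2)[of m t] M show ?thesis by linarith
    qed
    then show "\<forall>\<^sub>F m in sequentially. \<forall>t\<in>UNIV. dist (s m t) (f t) < e"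
      by (auto simp: eventually_sequentially)
  qed
  with s(1) show ?thesis unfolding integrable_fun_def approximates_def by blast
qed

text \<open>
  Change of variables: pulling a function back along \<open>h\<close> and applying the adjoint of \<open>R\<close>
  is dual to transporting a measure along \<open>h\<close> and applying \<open>R\<close>.
\<close>

lemma cabv_integral_transport:
  fixes f :: "'t::topological_space \<Rightarrow> 'k::real_or_complex ^ 'n"
    and R :: "('k ^ 'n) \<Rightarrow>\<^sub>L ('k ^ 'n)"
  assumes f: "integrable_fun f" and h: "continuous_on UNIV h"
    and R: "Vector_Spaces.linear (*s) (*s) (blinfun_apply R)"
  shows "cabv_integral f (cabv_op R (cabv_image h \<mu>))
    = cabv_integral (\<lambda>t. adjoint_op (blinfun_apply R) (f (h t))) \<mu>"
proof -
  let ?A = "adjoint_op (blinfun_apply R)"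
  obtain s where s: "approximates s f" using integrable_funE[OF f] .
  have sh: "simple_function borel (\<lambda>t. s m (h t))" for m
    using simple_function_comp[OF borel_measurable_continuous_onI[OF h] approximatesD(1)[OF s]] .
  have "approximates (\<lambda>m t. ?A (s m (h t))) (\<lambda>t. ?A (f (h t)))"
    unfolding approximates_def
  proof (intro conjI allI uniform_limitI)
    show "simple_function borel (\<lambda>t. ?A (s m (h t)))" for m
      using simple_function_compose1[OF sh] .
    fix e :: real assume "0 < e"
    have pos: "0 < norm R + 1" using norm_ge_zero[of R] by linarith
    then have "0 < e / (norm R + 1)" using \<open>0 < e\<close> by simp
    from approximatesD(2)[OF s this]
    show "\<forall>\<^sub>F m in sequentially. \<forall>t\<in>UNIV. dist (?A (s m (h t))) (?A (f (h t))) < e"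
    proof eventually_elim
      case (elim m)
      show ?case
      proof
        fix t
        have "dist (?A (s m (h t))) (?A (f (h t))) \<le> norm R * dist (s m (h t)) (f (h t))"
          using norm_adjoint_op_le[OF R] by (simp add: dist_norm adjoint_op_diff)
        also have "\<dots> \<le> (norm R + 1) * dist (s m (h t)) (f (h t))"
          by (intro mult_right_mono) auto
        also have "\<dots> < (norm R + 1) * (e / (norm R + 1))"
          using elim[rule_format, of "h t"] pos by (intro mult_strict_left_mono)
        also have "\<dots> = e" using pos by simp
        finally show "dist (?A (s m (h t))) (?A (f (h t))) < e" .
      qed
    qed
  qed
  then have "(\<lambda>m. simple_cabv_integral (\<lambda>t. ?A (s m (h t))) \<mu>)
      \<longlonglongrightarrow> cabv_integral (\<lambda>t. ?A (f (h t))) \<mu>"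
    by (rule cabv_integral_tendsto)
  moreover have "simple_cabv_integral (\<lambda>t. ?A (s m (h t))) \<mu>
      = simple_cabv_integral (s m) (cabv_op R (cabv_image h \<mu>))" for m
  proof -
    have "simple_cabv_integral (s m) (cabv_op R (cabv_image h \<mu>))
        = (\<Sum>x\<in>range (s m). scalar_prod (?A x) (cabv_apply \<mu> ((\<lambda>t. s m (h t)) -` {x})))"
    proof -
      have "cabv_apply (cabv_image h \<mu>) (s m -` {x}) = cabv_apply \<mu> ((\<lambda>t. s m (h t)) -` {x})" for x
      proof -
        have "(\<lambda>t. s m (h t)) -` {x} = h -` (s m -` {x})" by auto
        then show ?thesis
          using cabv_apply_cabv_image[OF h simple_function_borel_vimage[OF approximatesD(1)[OF s]]]
          by (simp only:)
      qed
      then show ?thesis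
        by (simp add: simple_cabv_integral_def cabv_op.rep_eq scalar_prod_adjoint_op[OF R])
    qed
    also have "\<dots> = (\<Sum>x\<in>range (\<lambda>t. s m (h t)).
        scalar_prod (?A x) (cabv_apply \<mu> ((\<lambda>t. s m (h t)) -` {x})))"
    proof (intro sum.mono_neutral_right ballI)
      show "finite (range (s m))"
        by (rule simple_function_borel_range[OF approximatesD(1)[OF s]])
      fix x assume "x \<in> range (s m) - range (\<lambda>t. s m (h t))"
      then have "s m (h t) \<noteq> x" for t by blast
      then have "(\<lambda>t. s m (h t)) -` {x} = {}" by blast
      then show "scalar_prod (?A x) (cabv_apply \<mu> ((\<lambda>t. s m (h t)) -` {x})) = 0"
        by (simp add: cabv_apply_empty scalar_prod.zero_right)
    qed auto
    also have "\<dots> = simple_cabv_integral (\<lambda>t. ?A (s m (h t))) \<mu>"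
      by (rule simple_cabv_integral_compose[OF sh, symmetric])
    finally show ?thesis ..
  qed
  ultimately have "(\<lambda>m. simple_cabv_integral (s m) (cabv_op R (cabv_image h \<mu>)))
      \<longlonglongrightarrow> cabv_integral (\<lambda>t. ?A (f (h t))) \<mu>" by simp
  with cabv_integral_tendsto[OF s] show ?thesis by (rule LIMSEQ_unique)
qed

section \<open>The weak* topology\<close>

lemma continuous_fun_bounded:
  fixes f :: "'t::metric_space \<Rightarrow> 'x::real_normed_vector"
  assumes "compact (UNIV :: 't set)" "continuous_on UNIV f"
  obtains C where "\<And>t. norm (f t) \<le> C"
  using compact_imp_bounded[OF compact_continuous_image[OF assms(2,1)]]
  unfolding bounded_iff by blast

text \<open>The subbasic weak* open sets are preimages of open sets under bounded functionals.\<close>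

lemma open_if_openin_weak_star:
  fixes U :: "('t::metric_space, 'k::real_or_complex ^ 'n) cabv set"
  assumes T: "compact (UNIV :: 't set)" and U: "openin weak_star U"
  shows "open U"
proof -
  have "open V" if V: "V \<in> {{\<mu>. cabv_integral f \<mu> \<in> U} | f U. continuous_on UNIV f \<and> open U}"
    for V :: "('t, 'k ^ 'n) cabv set"
  proof -
    obtain f U where f: "continuous_on UNIV f" and U: "open U"
      and V: "V = cabv_integral f -` U"
      using V by (auto simp: vimage_def)
    obtain C where "norm (f t) \<le> C" for t using continuous_fun_bounded[OF T f] by blast
    then have "bounded_linear (cabv_integral f)"
      by (rule bounded_linear_cabv_integral[OF integrable_fun_continuous[OF T f]])
    then have "continuous_on UNIV (cabv_integral f)"
      by (intro linear_continuous_on)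
    then show ?thesis unfolding V by (rule open_vimage[OF U])
  qed
  note basis = this
  have "generate_topology_on {{\<mu>. cabv_integral f \<mu> \<in> U} | f U. continuous_on UNIV f \<and> open U} U"
    using U by (simp add: weak_star_def openin_topology_generated_by)
  then show ?thesis
  proof (induction rule: generate_topology_on.induct)
    case (Basis s)
    then show ?case by (rule basis)
  qed auto
qed

lemma topspace_weak_star: "topspace weak_star = UNIV"
proof -
  have "UNIV \<in> {{\<mu>. cabv_integral f \<mu> \<in> U} | f U. continuous_on UNIV f \<and> open U}"
    by (rule CollectI, rule exI[of _ "\<lambda>_. 0"], rule exI[of _ UNIV]) simp
  then show ?thesis unfolding weak_star_def topology_generated_by_topspace by blast
qed

lemma closed_if_closedin_weak_star:
  fixes A :: "('t::metric_space, 'k::real_or_complex ^ 'n) cabv set"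
  assumes "compact (UNIV :: 't set)" "closedin weak_star A"
  shows "closed A"
  using open_if_openin_weak_star[OF assms(1), of "- A"] assms(2)
  by (simp add: closedin_def topspace_weak_star Compl_eq_Diff_UNIV closed_open)

text \<open>
  Lusin-type approximation of a simple function: prescribed values in the unit ball on finitely
  many disjoint closed sets extend continuously into the unit ball. Bump functions
  combine the values, and the result is pushed radially into the ball.
\<close>

lemma continuous_extension_unit_ball:
  fixes K :: "'i \<Rightarrow> 't::metric_space set" and x :: "'i \<Rightarrow> 'x::real_normed_vector"
  assumes I: "finite I" and K: "\<And>i. i \<in> I \<Longrightarrow> closed (K i)" "disjoint_family_on K I"
    and x: "\<And>i. i \<in> I \<Longrightarrow> norm (x i) \<le> 1"
  obtains f where "continuous_on UNIV f" "\<And>t. norm (f t) \<le> 1"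
    "\<And>i t. i \<in> I \<Longrightarrow> t \<in> K i \<Longrightarrow> f t = x i"
proof -
  have "\<exists>\<phi> :: 't \<Rightarrow> real. continuous_on UNIV \<phi> \<and>
      (\<forall>t\<in>K i. \<phi> t = 1) \<and> (\<forall>j\<in>I - {i}. \<forall>t\<in>K j. \<phi> t = 0)" if i: "i \<in> I" for i
  proof -
    let ?L = "\<Union>j\<in>I - {i}. K j"
    have "closed ?L" using I K(1) by (intro closed_UN) auto
    moreover have "disjnt (K i) ?L"
      using K(2) i unfolding disjnt_def disjoint_family_on_def by blast
    ultimately obtain \<phi> where "continuous_map euclidean (top_of_set {0..1::real}) \<phi>"
      "\<phi> ` ?L \<subseteq> {0}" "\<phi> ` K i \<subseteq> {1}"
      using Urysohn_lemma[OF metrizable_imp_normal_space[OF metrizable_space_euclidean],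
          of ?L "K i" 0 1] K(1)[OF i]
      by (metis closed_closedin disjnt_sym zero_le_one)
    then show ?thesis
      by (intro exI[of _ \<phi>]) (auto simp: continuous_map_in_subtopology)
  qed
  then obtain \<phi> :: "'i \<Rightarrow> 't \<Rightarrow> real" where \<phi>:
      "\<And>i. i \<in> I \<Longrightarrow> continuous_on UNIV (\<phi> i)"
      "\<And>i t. i \<in> I \<Longrightarrow> t \<in> K i \<Longrightarrow> \<phi> i t = 1"
      "\<And>i j t. i \<in> I \<Longrightarrow> j \<in> I \<Longrightarrow> j \<noteq> i \<Longrightarrow> t \<in> K j \<Longrightarrow> \<phi> i t = 0"
    by (metis Diff_iff singletonD)
  define g where "g t = (\<Sum>i\<in>I. \<phi> i t *\<^sub>R x i)" for t
  define f where "f t = (1 / max 1 (norm (g t))) *\<^sub>R g t" for t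
  show ?thesis
  proof
    have g: "continuous_on UNIV g"
      unfolding g_def by (intro continuous_intros \<phi>(1))
    then show "continuous_on UNIV f"
      unfolding f_def by (intro continuous_intros) auto
    show "norm (f t) \<le> 1" for t by (simp add: f_def)
    show "f t = x i" if i: "i \<in> I" "t \<in> K i" for i t
    proof -
      have "g t = (\<Sum>j\<in>I. if j = i then x i else 0)"
        unfolding g_def using \<phi>(2)[OF i] \<phi>(3)[OF _ i(1) _ i(2)] by (intro sum.cong) auto
      also have "\<dots> = x i" using I i(1) by simp
      finally show ?thesis using x[OF i(1)] by (simp add: f_def max_def)
    qed
  qed
qed

text \<open>
  The variation is the dual norm. On each cell of a partition the optimal test function is
  the direction of the measure of the cell; by regularity it can be kept on a closed part of
  the cell that carries almost all the variation, and extended continuously.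
\<close>

lemma norm_cabv_le_if_integrals_le:
  fixes \<mu> :: "('t::metric_space, 'k::real_or_complex ^ 'n) cabv"
  assumes T: "compact (UNIV :: 't set)"
    and a: "\<And>f. continuous_on UNIV f \<Longrightarrow> (\<And>t. norm (f t) \<le> 1) \<Longrightarrow> norm (cabv_integral f \<mu>) \<le> a"
  shows "norm \<mu> \<le> a"
proof (rule norm_cabv_leI)
  fix P :: "'t set set" assume P: "finite P" "P \<subseteq> sets borel" "partition_on UNIV P"
  interpret V: finite_measure "cabv_variation \<mu>" by (rule finite_measure_cabv_variation)
  let ?v = "measure (cabv_variation \<mu>)"
  have disj: "B \<inter> C = {}" if "B \<in> P" "C \<in> P" "B \<noteq> C" for B C
    using P(3) that unfolding partition_on_def by (auto dest: disjointD)
  have "\<forall>t. \<exists>B. B \<in> P \<and> t \<in> B" using P(3) unfolding partition_on_def by blast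
  then obtain cell where cell: "\<And>t. cell t \<in> P" "\<And>t. t \<in> cell t" by metis
  have cell_eq: "cell t = B \<longleftrightarrow> t \<in> B" if "B \<in> P" for B t
    using cell(2)[of t] disj[OF cell(1) that, of t] by blast
  then have cell_vimage: "cell -` {B} = B" if "B \<in> P" for B
    using that by (simp add: vimage_def)
  have range_cell: "range cell = P"
  proof
    show "P \<subseteq> range cell"
    proof
      fix B assume "B \<in> P"
      moreover have "B \<noteq> {}" using P(3) \<open>B \<in> P\<close> unfolding partition_on_def by blast
      ultimately show "B \<in> range cell" using cell_vimage by blast
    qed
  qed (use cell in auto)
  have "simple_function borel cell"
    unfolding simple_function_def using P(1,2) by (auto simp: range_cell cell_vimage)
  define x where "x B = inverse (norm (cabv_apply \<mu> B)) *\<^sub>R cabv_apply \<mu> B" for B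
  have norm_x: "norm (x B) \<le> 1" for B
    by (cases "cabv_apply \<mu> B = 0") (simp_all add: x_def)
  have x_prod: "scalar_prod (x B) (cabv_apply \<mu> B) = of_real (norm (cabv_apply \<mu> B))" for B
  proof (cases "cabv_apply \<mu> B = 0")
    case True
    then show ?thesis by (simp add: scalar_prod.zero_right)
  next
    case False
    let ?n = "norm (cabv_apply \<mu> B)"
    have "scalar_prod (x B) (cabv_apply \<mu> B) = inverse ?n *\<^sub>R of_real (?n\<^sup>2)"
      by (simp only: x_def scalar_prod.scaleR_left scalar_prod_self)
    also have "\<dots> = of_real (inverse ?n * ?n\<^sup>2)" by (simp only: scaleR_conv_of_real of_real_mult)
    also have "inverse ?n * ?n\<^sup>2 = ?n" using False by (simp add: power2_eq_square)
    finally show ?thesis .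
  qed
  let ?s = "\<lambda>t. x (cell t)"
  have s: "simple_function borel ?s"
    using \<open>simple_function borel cell\<close> by (rule simple_function_compose1)
  have "cabv_integral ?s \<mu> = of_real (\<Sum>B\<in>P. norm (cabv_apply \<mu> B))"
    by (simp add: cabv_integral_simple[OF s] range_cell cell_vimage x_prod
        simple_cabv_integral_compose[OF \<open>simple_function borel cell\<close>])
  then have norm_s: "norm (cabv_integral ?s \<mu>) = (\<Sum>B\<in>P. norm (cabv_apply \<mu> B))"
    by (simp add: sum_nonneg del: of_real_sum)
  show "(\<Sum>B\<in>P. norm (cabv_apply \<mu> B)) \<le> a"
  proof (rule field_le_epsilon)
    fix e :: real assume "0 < e"
    \<comment> \<open>The two functions compared below differ by at most 2, on \<open>card P\<close> sets of variation below \<open>d\<close>.\<close>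
    define d where "d = e / (2 * (card P + 1))"
    have "0 < d" using \<open>0 < e\<close> by (simp add: d_def)
    have "\<exists>K. closed K \<and> K \<subseteq> B \<and> ?v (B - K) < d" if "B \<in> P" for B
    proof -
      have B: "B \<in> sets borel" using that P(2) by (rule subsetD[rotated])
      have "\<exists>K U. closed K \<and> open U \<and> K \<subseteq> B \<and> B \<subseteq> U \<and> ?v (U - K) < d"
        by (rule borel_closed_open_approx[OF finite_measure_cabv_variation sets_cabv_variation
              B \<open>0 < d\<close>])
      then obtain K U where KU: "closed K" "open U" "K \<subseteq> B" "B \<subseteq> U" "?v (U - K) < d"
        by (elim exE conjE)
      have "?v (B - K) \<le> ?v (U - K)"
      proof (rule V.finite_measure_mono)
        show "B - K \<subseteq> U - K" using KU(4) by blast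
        show "U - K \<in> sets (cabv_variation \<mu>)"
          using KU(1,2) by (simp add: borel_closed borel_open sets.Diff)
      qed
      with KU show ?thesis by (intro exI[of _ K]) simp
    qed
    then obtain K where K: "\<And>B. B \<in> P \<Longrightarrow> closed (K B)" "\<And>B. B \<in> P \<Longrightarrow> K B \<subseteq> B"
      "\<And>B. B \<in> P \<Longrightarrow> ?v (B - K B) < d" by metis
    have "disjoint_family_on K P"
      unfolding disjoint_family_on_def
    proof (intro ballI impI)
      fix B C assume "B \<in> P" "C \<in> P" "B \<noteq> C"
      then show "K B \<inter> K C = {}" using disj[of B C] K(2)[of B] K(2)[of C] by blast
    qed
    then obtain f where f: "continuous_on UNIV f" "\<And>t. norm (f t) \<le> 1"
      "\<And>B t. B \<in> P \<Longrightarrow> t \<in> K B \<Longrightarrow> f t = x B"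
      using continuous_extension_unit_ball[of P K x] P(1) K(1) norm_x by metis
    let ?E = "\<Union>B\<in>P. B - K B"
    have E: "B - K B \<in> sets borel" if "B \<in> P" for B
      using that P(2) K(1) by (intro sets.Diff) auto
    have "?v ?E \<le> (\<Sum>B\<in>P. ?v (B - K B))"
      using P(1) E by (intro measure_UNION_le) auto
    also have "\<dots> \<le> card P * d"
      using K(3) sum_bounded_above[of P "\<lambda>B. ?v (B - K B)" d] by (simp add: less_imp_le)
    finally have v_E: "?v ?E \<le> card P * d" .
    have f_int: "integrable_fun f" by (rule integrable_fun_continuous[OF T f(1)])
    have s_int: "integrable_fun ?s"
      using approximates_simple[OF s] unfolding integrable_fun_def by blast
    have "norm (cabv_integral (\<lambda>t. ?s t - f t) \<mu>) \<le> 2 * ?v ?E"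
    proof (rule norm_cabv_integral_le[OF integrable_fun_diff[OF s_int f_int]])
      show "norm (?s t - f t) \<le> 2" for t
        using norm_triangle_ineq4[of "?s t" "f t"] norm_x[of "cell t"] f(2)[of t] by linarith
      show "?E \<in> sets borel" using P(1) E by (intro sets.finite_UN) auto
      show "?s t - f t = 0" if "t \<notin> ?E" for t
      proof -
        have "t \<in> K (cell t)" using that cell by blast
        then show ?thesis using f(3)[OF cell(1)] by simp
      qed
    qed
    also have "\<dots> \<le> 2 * (card P * d)" using v_E by simp
    also have "\<dots> \<le> e"
    proof -
      have "2 * (card P * d) \<le> 2 * ((card P + 1) * d)" using \<open>0 < d\<close> by simp
      also have "\<dots> = e" by (simp add: d_def field_simps)
      finally show ?thesis .
    qed
    finally have "norm (cabv_integral ?s \<mu> - cabv_integral f \<mu>) \<le> e"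
      by (simp add: cabv_integral_diff[OF s_int f_int])
    then have "norm (cabv_integral ?s \<mu>) \<le> norm (cabv_integral f \<mu>) + e"
      using norm_triangle_sub[of "cabv_integral ?s \<mu>" "cabv_integral f \<mu>"] by linarith
    then show "(\<Sum>B\<in>P. norm (cabv_apply \<mu> B)) \<le> a + e"
      using a[OF f(1,2)] unfolding norm_s by linarith
  qed
qed

text \<open>By duality the complement of the ball is a union of subbasic weak* open sets.\<close>

lemma closedin_weak_star_ball:
  assumes T: "compact (UNIV :: 't::metric_space set)"
  shows "closedin weak_star {\<mu> :: ('t, 'k::real_or_complex ^ 'n) cabv. norm \<mu> \<le> a}"
proof -
  let ?W = "\<lambda>f. {\<mu> :: ('t, 'k ^ 'n) cabv. cabv_integral f \<mu> \<in> - cball 0 a}"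
  let ?F = "{f :: 't \<Rightarrow> 'k ^ 'n. continuous_on UNIV f \<and> (\<forall>t. norm (f t) \<le> 1)}"
  have "openin weak_star (?W f)" if "f \<in> ?F" for f
    unfolding weak_star_def
  proof (rule topology_generated_by_Basis)
    have "open (- cball (0 :: 'k) a)" by (simp add: open_Compl)
    then show "?W f \<in> {{\<mu>. cabv_integral f \<mu> \<in> U} | f U. continuous_on UNIV f \<and> open U}"
      using that by blast
  qed
  then have "openin weak_star (\<Union>f\<in>?F. ?W f)" by (intro openin_Union) auto
  moreover have "(\<Union>f\<in>?F. ?W f) = - {\<mu>. norm \<mu> \<le> a}"
  proof (intro equalityI subsetI)
    fix \<mu> :: "('t, 'k ^ 'n) cabv" assume "\<mu> \<in> (\<Union>f\<in>?F. ?W f)"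
    then obtain f where f: "continuous_on UNIV f" "\<And>t. norm (f t) \<le> 1" "a < norm (cabv_integral f \<mu>)"
      by auto
    have "norm (cabv_integral f \<mu>) \<le> 1 * norm \<mu>"
      by (rule norm_cabv_integral_le_norm[OF integrable_fun_continuous[OF T f(1)] f(2)])
    with f(3) show "\<mu> \<in> - {\<mu>. norm \<mu> \<le> a}" by simp
  next
    fix \<mu> :: "('t, 'k ^ 'n) cabv" assume "\<mu> \<in> - {\<mu>. norm \<mu> \<le> a}"
    then have "\<not> norm \<mu> \<le> a" by simp
    then have "\<exists>f\<in>?F. \<not> norm (cabv_integral f \<mu>) \<le> a"
      using norm_cabv_le_if_integrals_le[OF T, of \<mu> a] by blast
    then show "\<mu> \<in> (\<Union>f\<in>?F. ?W f)" by auto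
  qed
  ultimately show ?thesis
    by (simp add: closedin_def topspace_weak_star Compl_eq_Diff_UNIV)
qed

section \<open>The operator in the variation norm\<close>

lemma norm_cabv_op_le: "norm (cabv_op R \<mu>) \<le> norm R * norm \<mu>"
proof (rule norm_cabv_leI)
  fix P :: "'a set set" assume P: "finite P" "P \<subseteq> sets borel" "partition_on UNIV P"
  have "(\<Sum>B\<in>P. norm (cabv_apply (cabv_op R \<mu>) B)) \<le> (\<Sum>B\<in>P. norm R * norm (cabv_apply \<mu> B))"
    by (intro sum_mono) (simp add: cabv_op.rep_eq norm_blinfun)
  also have "\<dots> = norm R * (\<Sum>B\<in>P. norm (cabv_apply \<mu> B))" by (rule sum_distrib_left[symmetric])
  also have "\<dots> \<le> norm R * norm \<mu>"
    unfolding norm_cabv_def[of \<mu>] using P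
    by (intro mult_left_mono variation_sums_le bdd_above_variation_sums) auto
  finally show "(\<Sum>B\<in>P. norm (cabv_apply (cabv_op R \<mu>) B)) \<le> norm R * norm \<mu>" .
qed

lemma borel_vimage_continuous:
  "continuous_on UNIV h \<Longrightarrow> B \<in> sets borel \<Longrightarrow> h -` B \<in> sets borel"
  using measurable_sets[OF borel_measurable_continuous_onI] by fastforce

lemma norm_cabv_image_le:
  assumes h: "continuous_on UNIV h"
  shows "norm (cabv_image h \<mu>) \<le> norm \<mu>"
proof (rule norm_cabv_leI)
  fix P :: "'a set set" assume P: "finite P" "P \<subseteq> sets borel" "partition_on UNIV P"
  have "(\<Sum>B\<in>P. norm (cabv_apply (cabv_image h \<mu>) B)) = (\<Sum>B\<in>P. norm (cabv_apply \<mu> (h -` B)))"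
    using P(2) by (intro sum.cong) (auto simp: cabv_apply_cabv_image[OF h])
  also have "\<dots> \<le> norm \<mu>"
  proof (rule sum_norm_cabv_le)
    show "disjoint_family_on (\<lambda>B. h -` B) P"
      unfolding disjoint_family_on_def
    proof (intro ballI impI)
      fix B C assume "B \<in> P" "C \<in> P" "B \<noteq> C"
      then have "B \<inter> C = {}" using P(3) unfolding partition_on_def by (auto dest: disjointD)
      then show "h -` B \<inter> h -` C = {}" by blast
    qed
    show "h -` B \<in> sets borel" if "B \<in> P" for B
      using that P(2) by (intro borel_vimage_continuous[OF h]) blast
  qed (rule P(1))
  finally show "(\<Sum>B\<in>P. norm (cabv_apply (cabv_image h \<mu>) B)) \<le> norm \<mu>" .
qed

lemma norm_transport_le:
  assumes "continuous_on UNIV h"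
  shows "norm (cabv_op R (cabv_image h \<mu>)) \<le> norm R * norm \<mu>"
  by (rule order_trans[OF norm_cabv_op_le mult_left_mono[OF norm_cabv_image_le[OF assms]]]) simp

lemma transport_diff:
  assumes h: "continuous_on UNIV h"
  shows "cabv_op R (cabv_image h (\<mu> - \<nu>)) = cabv_op R (cabv_image h \<mu>) - cabv_op R (cabv_image h \<nu>)"
  by (rule cabv_eqI)
    (simp add: minus_cabv_rep_eq cabv_op.rep_eq cabv_apply_cabv_image[OF h] blinfun.diff_right)

context
  fixes R :: "nat \<Rightarrow> 'x::banach \<Rightarrow>\<^sub>L 'x" and \<omega> :: "nat \<Rightarrow> 't::topological_space \<Rightarrow> 't"
  assumes R: "summable (\<lambda>i. norm (R i))" and \<omega>: "\<And>i. continuous_on UNIV (\<omega> i)"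
begin

lemma summable_norm_H_op: "summable (\<lambda>i. norm (cabv_op (R i) (cabv_image (\<omega> i) \<mu>)))"
  by (rule summable_comparison_test[OF _ summable_mult2[OF R, of "norm \<mu>"]])
    (simp add: norm_transport_le[OF \<omega>])

lemma H_op_sums: "(\<lambda>i. cabv_op (R i) (cabv_image (\<omega> i) \<mu>)) sums H_op R \<omega> \<mu>"
  unfolding H_op_def by (rule summable_sums[OF summable_norm_cancel[OF summable_norm_H_op]])

lemma norm_H_op_le: "norm (H_op R \<omega> \<mu>) \<le> (\<Sum>i. norm (R i)) * norm \<mu>"
proof -
  have "norm (H_op R \<omega> \<mu>) \<le> (\<Sum>i. norm (cabv_op (R i) (cabv_image (\<omega> i) \<mu>)))"
    unfolding H_op_def by (rule summable_norm[OF summable_norm_H_op])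
  also have "\<dots> \<le> (\<Sum>i. norm (R i) * norm \<mu>)"
    by (intro suminf_le norm_transport_le \<omega> summable_norm_H_op summable_mult2 R)
  also have "\<dots> = (\<Sum>i. norm (R i)) * norm \<mu>" by (rule suminf_mult2[OF R, symmetric])
  finally show ?thesis .
qed

lemma H_op_diff: "H_op R \<omega> (\<mu> - \<nu>) = H_op R \<omega> \<mu> - H_op R \<omega> \<nu>"
proof (rule sums_unique2)
  show "(\<lambda>i. cabv_op (R i) (cabv_image (\<omega> i) \<mu>) - cabv_op (R i) (cabv_image (\<omega> i) \<nu>))
      sums (H_op R \<omega> \<mu> - H_op R \<omega> \<nu>)"
    by (intro sums_diff H_op_sums)
  show "(\<lambda>i. cabv_op (R i) (cabv_image (\<omega> i) \<mu>) - cabv_op (R i) (cabv_image (\<omega> i) \<nu>))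
      sums H_op R \<omega> (\<mu> - \<nu>)"
    using H_op_sums[of "\<mu> - \<nu>"] by (simp only: transport_diff[OF \<omega>])
qed

end

section \<open>The operator in the Monge-Kantorovich norm\<close>

text \<open>
  The positivity of \<open>\<rho>\<close> keeps the quotient away from the conventions for division by zero in the
  extended nonnegative reals.
\<close>

lemma lip_const_on_le_iff:
  assumes "0 \<le> C" "\<And>x y. x \<in> S \<Longrightarrow> y \<in> S \<Longrightarrow> x \<noteq> y \<Longrightarrow> 0 < \<rho> x y"
  shows "lip_const_on S \<rho> \<sigma> f \<le> ennreal C \<longleftrightarrow>
    (\<forall>x\<in>S. \<forall>y\<in>S. x \<noteq> y \<longrightarrow> \<sigma> (f x) (f y) \<le> C * \<rho> x y)"
proof -
  have "ennreal (\<sigma> (f x) (f y)) / ennreal (\<rho> x y) \<le> ennreal C \<longleftrightarrow> \<sigma> (f x) (f y) \<le> C * \<rho> x y"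
    if "x \<in> S" "y \<in> S" "x \<noteq> y" for x y
  proof (cases "0 \<le> \<sigma> (f x) (f y)")
    case True
    note pos = assms(2)[OF that]
    show ?thesis
      unfolding divide_ennreal[OF True pos] ennreal_le_iff[OF \<open>0 \<le> C\<close>]
      by (rule pos_divide_le_eq[OF pos])
  next
    case False
    then have "ennreal (\<sigma> (f x) (f y)) = 0" by (simp add: ennreal_neg)
    moreover have "\<sigma> (f x) (f y) \<le> C * \<rho> x y"
      using False mult_nonneg_nonneg[OF \<open>0 \<le> C\<close> less_imp_le[OF assms(2)[OF that]]] by linarith
    ultimately show ?thesis by simp
  qed
  then show ?thesis unfolding lip_const_on_def Sup_le_iff by blast
qed

lemma lip_const_le_iff:
  assumes "0 \<le> C"
  shows "lip_const f \<le> ennreal C \<longleftrightarrow> (\<forall>x y. dist (f x) (f y) \<le> C * dist x y)"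
proof -
  have "(x \<noteq> y \<longrightarrow> dist (f x) (f y) \<le> C * dist x y) \<longleftrightarrow> dist (f x) (f y) \<le> C * dist x y" for x y
    by (cases "x = y") auto
  then show ?thesis
    unfolding lip_const_def by (subst lip_const_on_le_iff[OF assms]) auto
qed

lemma dist_le_lip_const:
  assumes "f \<in> Lip"
  shows "dist (f x) (f y) \<le> enn2real (lip_const f) * dist x y"
proof -
  have "lip_const f = ennreal (enn2real (lip_const f))"
    using assms by (simp add: Lip_def)
  then show ?thesis
    using lip_const_le_iff[of "enn2real (lip_const f)" f] by simp
qed

lemma Lip_continuous:
  assumes "f \<in> Lip"
  shows "continuous_on UNIV f"
proof -
  have "lipschitz_on (enn2real (lip_const f)) UNIV f"
    using dist_le_lip_const[OF assms] by (intro lipschitz_onI) auto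
  then show ?thesis by (rule lipschitz_on_continuous_on)
qed

lemma BL_norm_leD:
  assumes f: "f \<in> Lip" and BL: "BL_norm f \<le> 1"
  obtains C L where "0 \<le> C" "0 \<le> L" "C + L \<le> 1" "\<And>t. norm (f t) \<le> C"
    "\<And>x y. dist (f x) (f y) \<le> L * dist x y"
proof -
  let ?S = "SUP t. ennreal (norm (f t))"
  have "?S \<le> BL_norm f" "lip_const f \<le> BL_norm f" by (simp_all add: BL_norm_def)
  with BL have "?S \<le> 1" "lip_const f \<le> 1" by (blast intro: order_trans)+
  then have fin: "?S < top" "lip_const f < top"
    by (auto intro: le_less_trans[OF _ ennreal_one_less_top])
  define C where "C = enn2real ?S"
  define L where "L = enn2real (lip_const f)"
  have C: "?S = ennreal C" and L: "lip_const f = ennreal L"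
    using fin by (simp_all add: C_def L_def)
  have pos: "0 \<le> C" "0 \<le> L" by (simp_all add: C_def L_def)
  show ?thesis
  proof (rule that[OF pos])
    have "ennreal (C + L) = BL_norm f"
      using pos by (simp only: BL_norm_def C L ennreal_plus)
    then have "ennreal (C + L) \<le> ennreal 1" using BL by simp
    then show "C + L \<le> 1" by (simp only: ennreal_le_iff zero_le_one)
    show "norm (f t) \<le> C" for t
    proof -
      have "ennreal (norm (f t)) \<le> ?S" by (rule SUP_upper) simp
      then show ?thesis unfolding C using pos by (simp only: ennreal_le_iff)
    qed
    show "dist (f x) (f y) \<le> L * dist x y" for x y
      using dist_le_lip_const[OF f] by (simp add: L_def)
  qed
qed

lemma BL_norm_leI:
  assumes "0 \<le> C" "0 \<le> L" "C + L \<le> 1" "\<And>t. norm (f t) \<le> C"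
    "\<And>x y. dist (f x) (f y) \<le> L * dist x y"
  shows "f \<in> Lip" "BL_norm f \<le> 1"
proof -
  have L: "lip_const f \<le> ennreal L" using assms by (simp add: lip_const_le_iff)
  then show "f \<in> Lip" unfolding Lip_def by (auto intro: le_less_trans)
  have "BL_norm f \<le> ennreal C + ennreal L"
    unfolding BL_norm_def using assms(4) L by (intro add_mono SUP_least ennreal_leI)
  also have "\<dots> = ennreal (C + L)" using assms by simp
  also have "\<dots> \<le> ennreal 1" using assms(3) by (rule ennreal_leI)
  finally show "BL_norm f \<le> 1" by simp
qed

text \<open>
  On a compact space the Monge-Kantorovich norm is dominated by the variation, so the supremum
  that defines it is one of a bounded set; that set is nonempty because it contains the value
  at the zero function.
\<close>

context
  fixes \<mu> :: "('t::metric_space, 'k::real_or_complex ^ 'n) cabv"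
  assumes T: "compact (UNIV :: 't set)"
begin

lemma cabv_integral_le_MK_norm:
  assumes "f \<in> Lip" "BL_norm f \<le> 1"
  shows "norm (cabv_integral f \<mu>) \<le> MK_norm \<mu>"
  unfolding MK_norm_def
proof (rule cSup_upper)
  show "bdd_above {norm (cabv_integral f \<mu>) | f. f \<in> Lip \<and> BL_norm f \<le> 1}"
  proof (rule bdd_aboveI)
    fix z assume "z \<in> {norm (cabv_integral f \<mu>) | f. f \<in> Lip \<and> BL_norm f \<le> 1}"
    then obtain f where f: "f \<in> Lip" "BL_norm f \<le> 1" and z: "z = norm (cabv_integral f \<mu>)"
      by blast
    obtain C L where CL: "0 \<le> C" "0 \<le> L" "C + L \<le> 1" "\<And>t. norm (f t) \<le> C"
      "\<And>x y. dist (f x) (f y) \<le> L * dist x y" using BL_norm_leD[OF f] by blast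
    have "norm (f t) \<le> 1" for t using CL(4)[of t] CL(2,3) by linarith
    then have "norm (cabv_integral f \<mu>) \<le> 1 * norm \<mu>"
      by (rule norm_cabv_integral_le_norm[OF integrable_fun_continuous[OF T Lip_continuous[OF f(1)]]])
    then show "z \<le> norm \<mu>" by (simp add: z)
  qed
qed (use assms in blast)

lemma MK_norm_leI:
  assumes "\<And>f. f \<in> Lip \<Longrightarrow> BL_norm f \<le> 1 \<Longrightarrow> norm (cabv_integral f \<mu>) \<le> C"
  shows "MK_norm \<mu> \<le> C"
  unfolding MK_norm_def
proof (rule cSup_least)
  have "(\<lambda>_::'t. 0 :: 'k ^ 'n) \<in> Lip" "BL_norm (\<lambda>_::'t. 0 :: 'k ^ 'n) \<le> 1"
    using BL_norm_leI[of 0 0 "\<lambda>_::'t. 0 :: 'k ^ 'n"] by simp_all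
  then show "{norm (cabv_integral f \<mu>) | f. f \<in> Lip \<and> BL_norm f \<le> 1} \<noteq> {}" by blast
qed (use assms in blast)

lemma MK_norm_nonneg: "0 \<le> MK_norm \<mu>"
proof -
  have "(\<lambda>_::'t. 0 :: 'k ^ 'n) \<in> Lip" "BL_norm (\<lambda>_::'t. 0 :: 'k ^ 'n) \<le> 1"
    using BL_norm_leI[of 0 0 "\<lambda>_::'t. 0 :: 'k ^ 'n"] by simp_all
  then show ?thesis using cabv_integral_le_MK_norm norm_ge_zero order_trans by blast
qed

text \<open>
  Homogeneity extends the bound from the unit ball to all bounded Lipschitz functions. The case
  \<open>C + L = 0\<close>, where one cannot normalise, is that of the zero function.
\<close>

lemma cabv_integral_le_BL_MK:
  assumes C: "0 \<le> C" "\<And>t. norm (f t) \<le> C"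
    and L: "0 \<le> L" "\<And>x y. dist (f x) (f y) \<le> L * dist x y"
  shows "norm (cabv_integral f \<mu>) \<le> (C + L) * MK_norm \<mu>"
proof -
  have "lipschitz_on L UNIV f" using L by (intro lipschitz_onI) auto
  then have f: "integrable_fun f"
    by (intro integrable_fun_continuous[OF T] lipschitz_on_continuous_on)
  show ?thesis
  proof (cases "C + L = 0")
    case True
    then have "C = 0" using C(1) L(1) by linarith
    then show ?thesis using norm_cabv_integral_le_norm[OF f C(2)] True by simp
  next
    case False
    then have pos: "0 < C + L" using C(1) L(1) by linarith
    let ?g = "\<lambda>t. (1 / (C + L)) *\<^sub>R f t"
    have "norm (?g t) \<le> C / (C + L)" for t
      using C(2)[of t] pos by (simp add: divide_right_mono)
    moreover have "dist (?g x) (?g y) \<le> L / (C + L) * dist x y" for x y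
      using L(2)[of x y] pos
      by (simp add: dist_norm[of "f x"] dist_norm[of "_ *\<^sub>R _"] divide_right_mono flip: scaleR_diff_right)
    moreover have "C / (C + L) + L / (C + L) \<le> 1"
      using pos by (simp flip: add_divide_distrib)
    ultimately have "?g \<in> Lip" "BL_norm ?g \<le> 1"
      using BL_norm_leI[of "C / (C + L)" "L / (C + L)" ?g] C(1) L(1) by auto
    then have "norm (cabv_integral ?g \<mu>) \<le> MK_norm \<mu>" by (rule cabv_integral_le_MK_norm)
    then have "norm (cabv_integral f \<mu>) / (C + L) \<le> MK_norm \<mu>"
      using pos by (simp add: cabv_integral_scaleR[OF f])
    then show ?thesis using pos by (simp add: pos_divide_le_eq mult.commute)
  qed
qed

end

text \<open>
  A test function in the unit ball of the bounded Lipschitz norm, with sup norm \<open>C\<close> and Lipschitz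
  constant \<open>L\<close>, is turned by the \<open>i\<close>-th transport into one with sup norm at most \<open>\<parallel>R\<^sub>i\<parallel> C\<close> and
  Lipschitz constant at most \<open>\<parallel>R\<^sub>i\<parallel> L r\<^sub>i\<close>. The sum of the two is at most \<open>\<parallel>R\<^sub>i\<parallel> (1 + r\<^sub>i)\<close>.
\<close>

lemma norm_cabv_integral_transport_le:
  fixes \<mu> :: "('t::metric_space, 'k::real_or_complex ^ 'n) cabv"
    and R :: "('k ^ 'n) \<Rightarrow>\<^sub>L ('k ^ 'n)"
  assumes T: "compact (UNIV :: 't set)" and h: "h \<in> Lip"
    and R: "Vector_Spaces.linear (*s) (*s) (blinfun_apply R)"
    and f: "f \<in> Lip" "BL_norm f \<le> 1"
  shows "norm (cabv_integral f (cabv_op R (cabv_image h \<mu>)))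
    \<le> norm R * (1 + enn2real (lip_const h)) * MK_norm \<mu>"
proof -
  let ?r = "enn2real (lip_const h)" and ?A = "adjoint_op (blinfun_apply R)"
  obtain C L where CL: "0 \<le> C" "0 \<le> L" "C + L \<le> 1" "\<And>t. norm (f t) \<le> C"
    "\<And>x y. dist (f x) (f y) \<le> L * dist x y" using BL_norm_leD[OF f] by blast
  have "norm (cabv_integral (\<lambda>t. ?A (f (h t))) \<mu>)
      \<le> (norm R * C + norm R * (L * ?r)) * MK_norm \<mu>"
  proof (rule cabv_integral_le_BL_MK[OF T])
    show "norm (?A (f (h t))) \<le> norm R * C" for t
      using CL(4) by (intro order_trans[OF norm_adjoint_op_le[OF R]] mult_left_mono) auto
    show "dist (?A (f (h x))) (?A (f (h y))) \<le> norm R * (L * ?r) * dist x y" for x y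
    proof -
      have "dist (?A (f (h x))) (?A (f (h y))) \<le> norm R * dist (f (h x)) (f (h y))"
        using norm_adjoint_op_le[OF R] by (simp add: dist_norm adjoint_op_diff)
      also have "\<dots> \<le> norm R * (L * dist (h x) (h y))"
        by (intro mult_left_mono CL(5)) simp
      also have "\<dots> \<le> norm R * (L * (?r * dist x y))"
        by (intro mult_left_mono dist_le_lip_const[OF h] CL(2)) simp
      finally show ?thesis by (simp add: mult.assoc)
    qed
  qed (use CL in auto)
  also have "\<dots> \<le> norm R * (1 + ?r) * MK_norm \<mu>"
  proof (intro mult_right_mono MK_norm_nonneg[OF T])
    have "C + L * ?r \<le> 1 + 1 * ?r"
      using CL(1-3) by (intro add_mono mult_right_mono) auto
    then show "norm R * C + norm R * (L * ?r) \<le> norm R * (1 + ?r)"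
      by (simp add: mult_left_mono flip: distrib_left)
  qed
  finally show ?thesis
    using cabv_integral_transport[OF integrable_fun_continuous[OF T Lip_continuous[OF f(1)]]
        Lip_continuous[OF h] R] by simp
qed

lemma MK_norm_H_op_le:
  fixes \<mu> :: "('t::metric_space, 'k::real_or_complex ^ 'n) cabv"
    and R :: "nat \<Rightarrow> ('k ^ 'n) \<Rightarrow>\<^sub>L ('k ^ 'n)"
  assumes T: "compact (UNIV :: 't set)" and \<omega>: "\<And>i. \<omega> i \<in> Lip"
    and R: "\<And>i. Vector_Spaces.linear (*s) (*s) (blinfun_apply (R i))"
    and sum_R: "summable (\<lambda>i. norm (R i))"
    and sum_d: "summable (\<lambda>i. norm (R i) * (1 + enn2real (lip_const (\<omega> i))))"
  shows "MK_norm (H_op R \<omega> \<mu>)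
    \<le> (\<Sum>i. norm (R i) * (1 + enn2real (lip_const (\<omega> i)))) * MK_norm \<mu>"
proof (rule MK_norm_leI[OF T])
  let ?c = "\<lambda>i. norm (R i) * (1 + enn2real (lip_const (\<omega> i)))"
  fix f :: "'t \<Rightarrow> 'k ^ 'n" assume f: "f \<in> Lip" "BL_norm f \<le> 1"
  let ?I = "\<lambda>i. cabv_integral f (cabv_op (R i) (cabv_image (\<omega> i) \<mu>))"
  have bound: "norm (?I i) \<le> ?c i * MK_norm \<mu>" for i
    by (rule norm_cabv_integral_transport_le[OF T \<omega> R f])
  have sum_c: "summable (\<lambda>i. ?c i * MK_norm \<mu>)" by (rule summable_mult2[OF sum_d])
  have sum_I: "summable (\<lambda>i. norm (?I i))"
    by (rule summable_comparison_test[OF _ sum_c]) (use bound in simp)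
  have cont: "continuous_on UNIV f" by (rule Lip_continuous[OF f(1)])
  obtain C where "norm (f t) \<le> C" for t using continuous_fun_bounded[OF T cont] by blast
  then have "bounded_linear (cabv_integral f)"
    by (rule bounded_linear_cabv_integral[OF integrable_fun_continuous[OF T cont]])
  then have "?I sums cabv_integral f (H_op R \<omega> \<mu>)"
    by (rule bounded_linear.sums[OF _ H_op_sums[OF sum_R Lip_continuous[OF \<omega>]]])
  then have "norm (cabv_integral f (H_op R \<omega> \<mu>)) = norm (\<Sum>i. ?I i)"
    by (rule arg_cong[OF sums_unique])
  also have "\<dots> \<le> (\<Sum>i. norm (?I i))" by (rule summable_norm[OF sum_I])
  also have "\<dots> \<le> (\<Sum>i. ?c i * MK_norm \<mu>)" by (rule suminf_le[OF bound sum_I sum_c])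
  also have "\<dots> = (\<Sum>i. ?c i) * MK_norm \<mu>" by (rule suminf_mult2[OF sum_d, symmetric])
  finally show "norm (cabv_integral f (H_op R \<omega> \<mu>)) \<le> (\<Sum>i. ?c i) * MK_norm \<mu>" .
qed

theorem theorem3p2p2:
  fixes \<omega> :: "nat \<Rightarrow> 't::metric_space \<Rightarrow> 't"
    and R :: "nat \<Rightarrow> ('k::real_or_complex ^ 'n) \<Rightarrow>\<^sub>L ('k ^ 'n)"
    and r :: "nat \<Rightarrow> real"
    and H :: "('t, 'k ^ 'n) cabv \<Rightarrow> ('t, 'k ^ 'n) cabv"
    and d a :: real
    and \<mu>0 :: "('t, 'k ^ 'n) cabv"
  assumes T_compact: "compact (UNIV :: 't set)"
    and T_two: "\<exists>x y :: 't. x \<noteq> y"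
    and \<omega>_Lip: "\<And>i. \<omega> i \<in> Lip"
    and r_def: "\<And>i. r i = enn2real (lip_const (\<omega> i))"
    and r_bounded: "bdd_above (range r)"
    and R_linear: "\<And>i. Vector_Spaces.linear (*s) (*s) (blinfun_apply (R i))"
    and R_summable: "summable (\<lambda>i. norm (R i))"
    and H_def: "H = H_op R \<omega>"
    and d_def: "d = (\<Sum>i. norm (R i) * (1 + r i))"
    and a_pos: "0 < a"
  shows
    "((\<forall>i. contraction_on UNIV dist (\<omega> i)) \<and> (\<Sum>i. norm (R i)) \<le> 1 / 2 \<longrightarrow> d < 1) \<and>
     (norm \<mu>0 + a * (\<Sum>i. norm (R i)) \<le> a \<longrightarrow>
        {\<mu> :: ('t, 'k ^ 'n) cabv. norm \<mu> \<le> a} \<noteq> {} \<and>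
        closedin weak_star {\<mu> :: ('t, 'k ^ 'n) cabv. norm \<mu> \<le> a} \<and>
        (\<forall>\<mu>. norm \<mu> \<le> a \<longrightarrow> norm (H \<mu> + \<mu>0) \<le> a)) \<and>
     (\<forall>A. d < 1 \<longrightarrow> A \<noteq> {} \<longrightarrow> A \<subseteq> {\<mu>. norm \<mu> \<le> a} \<longrightarrow> closedin weak_star A \<longrightarrow>
        (\<forall>\<mu>\<in>A. H \<mu> + \<mu>0 \<in> A) \<longrightarrow>
        contraction_on A MK_dist (\<lambda>\<mu>. H \<mu> + \<mu>0) \<and>
        lip_const_on A MK_dist MK_dist (\<lambda>\<mu>. H \<mu> + \<mu>0) \<le> ennreal d \<and>
        (\<mu>0 = 0 \<longrightarrow> 0 \<in> A) \<and>
        (\<exists>\<mu>s\<in>A. H \<mu>s + \<mu>0 = \<mu>s \<and> (\<forall>\<nu>\<in>A. H \<nu> + \<mu>0 = \<nu> \<longrightarrow> \<nu> = \<mu>s) \<and>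
           (\<mu>0 = 0 \<longrightarrow> \<mu>s = 0)))"
proof -
  let ?q = "\<Sum>i. norm (R i)"
  have \<omega>: "continuous_on UNIV (\<omega> i)" for i by (rule Lip_continuous[OF \<omega>_Lip])
  have r_nonneg: "0 \<le> r i" for i by (simp add: r_def)
  obtain b where b: "r i \<le> b" for i using r_bounded by (auto simp: bdd_above_def)
  have sum_d: "summable (\<lambda>i. norm (R i) * (1 + r i))"
  proof (rule summable_comparison_test[OF _ summable_mult2[OF R_summable, of "1 + b"]])
    have "norm (norm (R i) * (1 + r i)) \<le> norm (R i) * (1 + b)" for i
      using r_nonneg[of i] b[of i] by (simp add: abs_mult mult_left_mono)
    then show "\<exists>N. \<forall>i\<ge>N. norm (norm (R i) * (1 + r i)) \<le> norm (R i) * (1 + b)" by blast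
  qed
  have q_nonneg: "0 \<le> ?q" by (rule suminf_nonneg[OF R_summable norm_ge_zero])
  have q_le_d: "?q \<le> d"
    unfolding d_def
  proof (rule suminf_le[OF _ R_summable sum_d])
    show "norm (R i) \<le> norm (R i) * (1 + r i)" for i
      using mult_left_mono[of 1 "1 + r i" "norm (R i)"] r_nonneg[of i] by simp
  qed
  have norm_H: "norm (H \<mu>) \<le> ?q * norm \<mu>" for \<mu>
    unfolding H_def by (rule norm_H_op_le[OF R_summable \<omega>])
  have H_diff: "H (\<mu> - \<nu>) = H \<mu> - H \<nu>" for \<mu> \<nu>
    unfolding H_def by (rule H_op_diff[OF R_summable \<omega>])
  have H_0: "H 0 = 0" using H_diff[of 0 0] by simp
  have MK_H: "MK_dist (H \<mu> + \<mu>0) (H \<nu> + \<mu>0) \<le> d * MK_dist \<mu> \<nu>" for \<mu> \<nu>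
    using MK_norm_H_op_le[OF T_compact \<omega>_Lip R_linear R_summable sum_d[unfolded r_def], of "\<mu> - \<nu>"]
    by (simp add: MK_dist_def d_def r_def H_diff flip: H_def)

  \<comment> \<open>\<open>2 * (\<Sum>i. norm (R i)) - d\<close> is a series of terms \<open>norm (R i) * (1 - r i) \<ge> 0\<close>, and one is positive unless all \<open>R i\<close> vanish.\<close>
  have small: "d < 1" if contr: "\<forall>i. contraction_on UNIV dist (\<omega> i)" and q: "?q \<le> 1 / 2"
  proof (cases "\<forall>i. R i = 0")
    case True
    then show ?thesis by (simp add: d_def)
  next
    case False
    then obtain j where j: "R j \<noteq> 0" by blast
    have r_less: "r i < 1" for i
    proof -
      have "lip_const (\<omega> i) < ennreal 1"
        using contr by (simp add: contraction_on_def lip_const_def)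
      then show ?thesis unfolding r_def by (cases "lip_const (\<omega> i)") auto
    qed
    have "0 < (\<Sum>i. 2 * norm (R i) - norm (R i) * (1 + r i))"
    proof (rule suminf_pos2)
      show "summable (\<lambda>i. 2 * norm (R i) - norm (R i) * (1 + r i))"
        by (intro summable_diff summable_mult R_summable sum_d)
      have eq: "2 * norm (R i) - norm (R i) * (1 + r i) = norm (R i) * (1 - r i)" for i
        by (simp add: algebra_simps)
      show "0 \<le> 2 * norm (R i) - norm (R i) * (1 + r i)" for i
        unfolding eq using r_less[of i] by simp
      show "0 < 2 * norm (R j) - norm (R j) * (1 + r j)"
        unfolding eq using r_less[of j] j by simp
    qed
    also have "\<dots> = 2 * ?q - d"
      unfolding d_def
      by (simp only: suminf_diff[OF summable_mult[OF R_summable] sum_d, symmetric]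
          suminf_mult[OF R_summable])
    finally show ?thesis using q by linarith
  qed

  have ball: "norm (H \<mu> + \<mu>0) \<le> a" if "norm \<mu>0 + a * ?q \<le> a" "norm \<mu> \<le> a" for \<mu>
  proof -
    have "norm (H \<mu> + \<mu>0) \<le> norm (H \<mu>) + norm \<mu>0" by (rule norm_triangle_ineq)
    also have "norm (H \<mu>) \<le> ?q * a"
      by (rule order_trans[OF norm_H mult_left_mono[OF that(2) q_nonneg]])
    finally show ?thesis using that(1) by (simp add: mult.commute)
  qed

  have main: "contraction_on A MK_dist (\<lambda>\<mu>. H \<mu> + \<mu>0) \<and>
      lip_const_on A MK_dist MK_dist (\<lambda>\<mu>. H \<mu> + \<mu>0) \<le> ennreal d \<and>
      (\<mu>0 = 0 \<longrightarrow> 0 \<in> A) \<and>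
      (\<exists>\<mu>s\<in>A. H \<mu>s + \<mu>0 = \<mu>s \<and> (\<forall>\<nu>\<in>A. H \<nu> + \<mu>0 = \<nu> \<longrightarrow> \<nu> = \<mu>s) \<and> (\<mu>0 = 0 \<longrightarrow> \<mu>s = 0))"
    if d: "d < 1" and A: "A \<noteq> {}" "closedin weak_star A" "\<forall>\<mu>\<in>A. H \<mu> + \<mu>0 \<in> A" for A
  proof -
    have lip: "lip_const_on A MK_dist MK_dist (\<lambda>\<mu>. H \<mu> + \<mu>0) \<le> ennreal d"
      unfolding lip_const_on_def
    proof (rule Sup_least, clarify)
      fix \<mu> \<nu> :: "('t, 'k ^ 'n) cabv"
      have nonneg: "0 \<le> MK_dist \<mu> \<nu>" for \<mu> \<nu> :: "('t, 'k ^ 'n) cabv"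
        unfolding MK_dist_def by (rule MK_norm_nonneg[OF T_compact])
      show "ennreal (MK_dist (H \<mu> + \<mu>0) (H \<nu> + \<mu>0)) / ennreal (MK_dist \<mu> \<nu>) \<le> ennreal d"
      proof (cases "MK_dist \<mu> \<nu> = 0")
        case True
        \<comment> \<open>The numerator vanishes as well, and \<open>0 / 0 = 0\<close> in the extended nonnegative reals.\<close>
        then have "MK_dist (H \<mu> + \<mu>0) (H \<nu> + \<mu>0) = 0"
          using MK_H[of \<mu> \<nu>] nonneg[of "H \<mu> + \<mu>0" "H \<nu> + \<mu>0"] by simp
        then show ?thesis by simp
      next
        case False
        then have pos: "0 < MK_dist \<mu> \<nu>" using nonneg[of \<mu> \<nu>] by linarith
        show ?thesis
          unfolding divide_ennreal[OF nonneg pos]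
          using MK_H[of \<mu> \<nu>] pos by (intro ennreal_leI) (simp add: pos_divide_le_eq)
      qed
    qed
    moreover have "ennreal d < 1"
      using d by (simp add: ennreal_less_one_iff)
    ultimately have contraction: "contraction_on A MK_dist (\<lambda>\<mu>. H \<mu> + \<mu>0)"
      unfolding contraction_on_def using A(3) by (auto intro: le_less_trans)

    \<comment> \<open>The fixed point is obtained in the variation norm, whose contraction factor is \<open>?q\<close>.\<close>
    have "complete A"
      using closed_if_closedin_weak_star[OF T_compact A(2)] by (simp add: complete_eq_closed)
    then have "\<exists>!\<mu>\<in>A. H \<mu> + \<mu>0 = \<mu>"
    proof (rule Banach_fix[OF _ A(1) q_nonneg])
      show "?q < 1" using q_le_d d by linarith
      show "(\<lambda>\<mu>. H \<mu> + \<mu>0) ` A \<subseteq> A" using A(3) by blast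
      show "dist (H \<mu> + \<mu>0) (H \<nu> + \<mu>0) \<le> ?q * dist \<mu> \<nu>" for \<mu> \<nu>
        using norm_H[of "\<mu> - \<nu>"] by (simp add: dist_norm H_diff)
    qed
    then obtain \<mu>s where \<mu>s: "\<mu>s \<in> A" "H \<mu>s + \<mu>0 = \<mu>s" "\<forall>\<nu>\<in>A. H \<nu> + \<mu>0 = \<nu> \<longrightarrow> \<nu> = \<mu>s"
      by blast
    have zero: "\<mu>s = 0" if "\<mu>0 = 0"
    proof (rule ccontr)
      assume "\<mu>s \<noteq> 0"
      have "norm \<mu>s \<le> ?q * norm \<mu>s" using norm_H[of \<mu>s] \<mu>s(2) that by simp
      also have "\<dots> < 1 * norm \<mu>s"
        using q_le_d d \<open>\<mu>s \<noteq> 0\<close> by (intro mult_strict_right_mono) auto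
      finally show False by simp
    qed
    with \<mu>s(1) have "\<mu>0 = 0 \<longrightarrow> 0 \<in> A" by auto
    then show ?thesis using contraction lip \<mu>s zero by blast
  qed

  have "(0 :: ('t, 'k ^ 'n) cabv) \<in> {\<mu>. norm \<mu> \<le> a}" using a_pos by simp
  then have nonempty: "{\<mu> :: ('t, 'k ^ 'n) cabv. norm \<mu> \<le> a} \<noteq> {}" by blast
  show ?thesis
    using small ball nonempty closedin_weak_star_ball[OF T_compact] main by (intro conjI impI allI) simp_all
qed

end
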